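(* Let $a,b,c_1,c_2,c_3$ be real constants and set $$\mathfrak{C}=ac_1+bc_2+2c_1^2+2c_2^2,\qquad \mathfrak{B}=2c_1a+3c_1^2+c_2b+3c_2^2 .$$ Suppose that: 1. $u=u(z)$ is a periodic solution, with period $\tau$, of $u'(z)^2+e^{2u(z)}+c_3^2e^{-6u(z)}-\mathfrak{C}=0$; 2. $c_1\in\mathbb{Q}$ and $\displaystyle \frac{c_3\mathfrak{C}\tau}{2\pi}\int_0^\tau\frac{e^{-3u(z)}}{e^{2u(z)}-\mathfrak{C}}\,dz\in\mathbb{Q}$; 3. $\alpha_1,\alpha_2,\alpha_3$ are distinct rational roots of the equation $\alpha^3+a\alpha^2-\mathfrak{B}\alpha+c_1\mathfrak{C}=0$. Put $\beta_j=\dfrac{c_2\alpha_j}{\alpha_j-c_1}$ for $j=1,2,3$, $$P(z)=e^{u(z)+ic_3\int e^{-3u(z)}dz},\qquad Q(z)=\sqrt{\mathfrak{C}-e^{2u(z)}}\;e^{ic_3\int\frac{e^{-u(z)}}{e^{2u(z)}-\mathfrak{C}}dz},$$ $$\gamma_1=\sqrt{\tfrac{\mathfrak{C}+\alpha_2\alpha_3}{\mathfrak{C}(\alpha_1-\alpha_2)(\alpha_1-\alpha_3)}},\quad \gamma_2=\sqrt{\tfrac{\mathfrak{C}+\alpha_1\alpha_3}{\mathfrak{C}(\alpha_2-\alpha_1)(\alpha_2-\alpha_3)}},\quad \gamma_3=\sqrt{\tfrac{\mathfrak{C}+\alpha_1\alpha_2}{\mathfrak{C}(\alpha_3-\alpha_1)(\alpha_3-\alpha_2)}},\quad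 \gamma_4=\sqrt{\tfrac1{\mathfrak{C}}},$$ and let $\psi:\mathbb{R}^3\to\mathbb{S}^7\subset\mathbb{C}^4$ be given by $$\psi(x,y,z)=\bigl(\gamma_1P(z)e^{i(x\alpha_1+y\beta_1)},\ \gamma_2P(z)e^{i(x\alpha_2+y\beta_2)},\ \gamma_3P(z)e^{i(x\alpha_3+y\beta_3)},\ \gamma_4Q(z)\bigr).$$ Then the map $\mathcal{H}\circ\psi:\mathbb{R}^3\to\mathbb{CP}^3$ defines a conformally flat H-minimal Lagrangian torus in $\mathbb{CP}^3$.
   Context: $\mathbb{S}^7$ is the unit sphere in $\mathbb{C}^4$ with Hermitian product $\langle u,v\rangle=\sum_{k=1}^4u_k\bar v_k$, and $\mathcal{H}:\mathbb{S}^7\to\mathbb{CP}^3$ is the Hopf map. $\mathbb{CP}^3$ carries the Fubini–Study Hermitian structure, the product of two tangent vectors being the Hermitian product of their horizontal lifts by $\mathcal{H}$; the metric is its real part and the Kähler form $\omega$ its imaginary part. An immersion $f$ of a 3-manifold into $\mathbb{CP}^3$ is Lagrangian if $f^*\omega=0$. A Lagrangian submanifold is Hamiltonian-minimal (H-minimal) if it is a critical point of the volume under Hamiltonian deformations. "Conformally flat" means that the induced metric in the coordinates $(x,y,z)$ is a positive function times $dx^2+dy^2+dz^2$. An integral sign without limits denotes an antiderivative in $z$; $u'=du/dz$.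
   Formalization: In condition 2 the factor τ before the integral is dropped, since for nonconstant u a torus exists only if the number without τ is rational; u is taken smooth, excluding C¹ solutions that pause at turning points; e^{2u}≠𝔠 and α_j≠c₁ are assumed so that the formulas are defined. *)

theory Defs
  imports "HOL-Analysis.Analysis"
begin

text \<open>Smoothness on an open set: all iterated directional derivatives exist and are continuous.\<close>

primrec higher_differentiable_on ::
  "nat \<Rightarrow> 'a::real_normed_vector set \<Rightarrow> ('a \<Rightarrow> 'b::real_normed_vector) \<Rightarrow> bool" where
  "higher_differentiable_on 0 S f \<longleftrightarrow> continuous_on S f"
| "higher_differentiable_on (Suc n) S f \<longleftrightarrow>
     (\<forall>x\<in>S. f differentiable (at x)) \<and>
     (\<forall>v. higher_differentiable_on n S (\<lambda>x. frechet_derivative f (at x) v))"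

definition smooth_on :: "'a::real_normed_vector set \<Rightarrow> ('a \<Rightarrow> 'b::real_normed_vector) \<Rightarrow> bool" where
  "smooth_on S f \<longleftrightarrow> (\<forall>n. higher_differentiable_on n S f)"

definition herm :: "complex ^ 4 \<Rightarrow> complex ^ 4 \<Rightarrow> complex" where
  "herm u v = (\<Sum>k\<in>UNIV. u $ k * cnj (v $ k))"

text \<open>A point of complex projective 3-space is a fibre of the Hopf map, that is, an orbit of the
  unit circle on the unit sphere.\<close>

definition hopf :: "complex ^ 4 \<Rightarrow> (complex ^ 4) set" where
  "hopf q = {cis t *s q | t. True}"

text \<open>For \<open>norm q = 1\<close> this is the component of \<open>w\<close> that is Hermitian orthogonal to \<open>q\<close>. On the
  tangent space of the sphere at \<open>q\<close> it is the projection onto the horizontal space of the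
  Hopf map.\<close>

definition horizontal :: "complex ^ 4 \<Rightarrow> complex ^ 4 \<Rightarrow> complex ^ 4" where
  "horizontal q w = w - herm w q *s q"

text \<open>
  A smooth map \<open>F\<close> into complex projective space with domain \<open>\<real>\<^sup>3\<close>, or \<open>\<real>\<^sup>3\<close> times an interval, is
  given by a smooth map \<open>\<phi>\<close> into the unit sphere with \<open>F = hopf \<circ> \<phi>\<close>. As these domains are
  contractible, every smooth map has such a lift \<open>\<phi>\<close>; it is unique up to a smooth phase.

  \<open>dhopf \<phi> p v\<close> is the horizontal lift, at the point \<open>\<phi> p\<close>, of the tangent vector
  \<open>d(hopf \<circ> \<phi>)\<^sub>p(v)\<close>, and \<open>fs_form \<phi>\<close> is the pull-back by \<open>hopf \<circ> \<phi>\<close> of the Fubini-Study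
  Hermitian structure. Its real part is the induced metric and its imaginary part the pull-back
  of the Kaehler form. It depends only on \<open>hopf \<circ> \<phi>\<close>: see \<open>fs_form_cong\<close> below.
\<close>

definition dhopf ::
  "('a::real_normed_vector \<Rightarrow> complex ^ 4) \<Rightarrow> 'a \<Rightarrow> 'a \<Rightarrow> complex ^ 4" where
  "dhopf \<phi> p v = horizontal (\<phi> p) (frechet_derivative \<phi> (at p) v)"

definition fs_form ::
  "('a::real_normed_vector \<Rightarrow> complex ^ 4) \<Rightarrow> 'a \<Rightarrow> 'a \<Rightarrow> 'a \<Rightarrow> complex" where
  "fs_form \<phi> p v w = herm (dhopf \<phi> p v) (dhopf \<phi> p w)"

definition lattice_of :: "real ^ 3 ^ 3 \<Rightarrow> (real ^ 3) set" where
  "lattice_of A = range (\<lambda>n :: int ^ 3. A *v (\<chi> i. real_of_int (n $ i)))"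

text \<open>\<open>hopf \<circ> \<phi>\<close> is an immersion that descends to the torus \<open>\<real>\<^sup>3 / lattice_of A\<close>.\<close>

definition immersed_torus :: "real ^ 3 ^ 3 \<Rightarrow> (real ^ 3 \<Rightarrow> complex ^ 4) \<Rightarrow> bool" where
  "immersed_torus A \<phi> \<longleftrightarrow>
     invertible A \<and>
     smooth_on UNIV \<phi> \<and> (\<forall>p. \<phi> p \<in> sphere 0 1) \<and>
     (\<forall>p v. v \<noteq> 0 \<longrightarrow> dhopf \<phi> p v \<noteq> 0) \<and>
     (\<forall>p. \<forall>l\<in>lattice_of A. hopf (\<phi> (p + l)) = hopf (\<phi> p))"

definition lagrangian :: "(real ^ 3 \<Rightarrow> complex ^ 4) \<Rightarrow> bool" where
  "lagrangian \<phi> \<longleftrightarrow> (\<forall>p v w. Im (fs_form \<phi> p v w) = 0)"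

definition conformally_flat :: "(real ^ 3 \<Rightarrow> complex ^ 4) \<Rightarrow> bool" where
  "conformally_flat \<phi> \<longleftrightarrow>
     (\<exists>\<rho>. (\<forall>p. \<rho> p > 0) \<and> (\<forall>p v w. Re (fs_form \<phi> p v w) = \<rho> p * (v \<bullet> w)))"

text \<open>The volume of the torus \<open>\<real>\<^sup>3 / lattice_of A\<close> in the metric induced by \<open>hopf \<circ> \<phi>\<close>, computed on
  a fundamental parallelepiped.\<close>

definition torus_volume :: "real ^ 3 ^ 3 \<Rightarrow> (real ^ 3 \<Rightarrow> complex ^ 4) \<Rightarrow> real" where
  "torus_volume A \<phi> =
     integral ((\<lambda>s. A *v s) ` {s. \<forall>i. 0 \<le> s $ i \<and> s $ i \<le> 1})
       (\<lambda>p. sqrt (det (\<chi> i j. Re (fs_form \<phi> p (axis i 1) (axis j 1)))))"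

text \<open>
  A Hamiltonian deformation of the torus: a smooth family of maps \<open>p \<mapsto> hopf (\<Phi> (t, p))\<close> of the
  torus that starts at \<open>hopf \<circ> \<phi>\<close> and whose variation field \<open>V\<close> at \<open>t = 0\<close> is Hamiltonian, that is,
  the 1-form \<open>\<omega>(V, -)\<close> is exact on the torus. Here \<open>fs_form \<Phi> (0, p) (1, 0) (0, v)\<close> is the
  Hermitian product of \<open>V\<close> with the derivative of \<open>hopf \<circ> \<phi>\<close> in the direction \<open>v\<close>. Nothing is asked
  of the velocity at \<open>t \<noteq> 0\<close>, so deformations that are Hamiltonian at all times are included.
\<close>

definition hamiltonian_deformation ::
  "real ^ 3 ^ 3 \<Rightarrow> (real ^ 3 \<Rightarrow> complex ^ 4) \<Rightarrow> real \<Rightarrow> (real \<times> (real ^ 3) \<Rightarrow> complex ^ 4) \<Rightarrow> bool" where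
  "hamiltonian_deformation A \<phi> \<epsilon> \<Phi> \<longleftrightarrow>
     \<epsilon> > 0 \<and>
     smooth_on ({-\<epsilon><..<\<epsilon>} \<times> UNIV) \<Phi> \<and>
     (\<forall>t\<in>{-\<epsilon><..<\<epsilon>}. \<forall>p. \<Phi> (t, p) \<in> sphere 0 1) \<and>
     (\<forall>t\<in>{-\<epsilon><..<\<epsilon>}. \<forall>p. \<forall>l\<in>lattice_of A. hopf (\<Phi> (t, p + l)) = hopf (\<Phi> (t, p))) \<and>
     (\<forall>p. hopf (\<Phi> (0, p)) = hopf (\<phi> p)) \<and>
     (\<exists>h :: real ^ 3 \<Rightarrow> real.
        smooth_on UNIV h \<and> (\<forall>p. \<forall>l\<in>lattice_of A. h (p + l) = h p) \<and>
        (\<forall>p v. Im (fs_form \<Phi> (0, p) (1, 0) (0, v)) = frechet_derivative h (at p) v))"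

definition hamiltonian_minimal :: "real ^ 3 ^ 3 \<Rightarrow> (real ^ 3 \<Rightarrow> complex ^ 4) \<Rightarrow> bool" where
  "hamiltonian_minimal A \<phi> \<longleftrightarrow>
     (\<forall>\<epsilon> \<Phi>. hamiltonian_deformation A \<phi> \<epsilon> \<Phi> \<longrightarrow>
        ((\<lambda>t. torus_volume A (\<lambda>p. \<Phi> (t, p))) has_real_derivative 0) (at 0))"

lemma herm_simps:
  "herm (u + v) w = herm u w + herm v w" "herm (u - v) w = herm u w - herm v w"
  "herm (c *s u) w = c * herm u w" "herm w (c *s u) = cnj c * herm w u"
  by (simp_all only: herm_def vector_add_component vector_minus_component vector_smult_component
      complex_cnj_mult sum.distrib sum_subtractf sum_distrib_left ring_distribs mult_ac)

lemma herm_add_right: "herm w (u + v) = herm w u + herm w v"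
  by (simp only: herm_def vector_add_component complex_cnj_add sum.distrib ring_distribs)

lemma herm_self: "herm u u = of_real ((norm u)\<^sup>2)"
  by (simp add: herm_def norm_vec_def L2_set_def sum_nonneg complex_norm_square
      del: of_real_power)

lemma scaleR_cscale: "r *\<^sub>R v = complex_of_real r *s v"
  for v :: "complex ^ 4"
  by (simp add: vec_eq_iff flip: scaleR_conv_of_real)

lemma bounded_bilinear_herm: "bounded_bilinear herm"
proof (rule bounded_bilinear.intro)
  show "\<exists>K. \<forall>a b. norm (herm a b) \<le> norm a * norm b * K"
  proof (intro exI[of _ "4"] allI)
    fix a b :: "complex ^ 4"
    have "norm (a $ k * cnj (b $ k)) \<le> norm a * norm b" for k
      unfolding norm_mult complex_mod_cnj
      by (intro mult_mono Finite_Cartesian_Product.norm_nth_le norm_ge_zero)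
    then have "norm (herm a b) \<le> of_nat CARD(4) * (norm a * norm b)"
      unfolding herm_def by (intro sum_norm_bound)
    then show "norm (herm a b) \<le> norm a * norm b * 4" by simp
  qed
qed (simp_all only: herm_simps herm_add_right scaleR_cscale scaleR_conv_of_real complex_cnj_complex_of_real)

lemma bounded_bilinear_cscale: "bounded_bilinear (\<lambda>c (v :: complex ^ 4). c *s v)"
proof (rule bounded_bilinear.intro)
  have "norm (a *s b) = norm a * norm b" for a and b :: "complex ^ 4"
    by (simp add: norm_vec_def norm_mult L2_set_right_distrib)
  then show "\<exists>K. \<forall>a (b :: complex ^ 4). norm (a *s b) \<le> norm a * norm b * K"
    by (intro exI[of _ 1]) simp
qed (simp_all add: vec_eq_iff ring_distribs)

text \<open>Two lifts of the same map into complex projective space have the same form.\<close>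

lemma fs_form_cong:
  fixes \<phi> \<xi> :: "'a::real_normed_vector \<Rightarrow> complex ^ 4"
  assumes S: "open S" "p \<in> S"
    and sphere: "\<And>q. q \<in> S \<Longrightarrow> \<phi> q \<in> sphere 0 1"
    and fibre: "\<And>q. q \<in> S \<Longrightarrow> hopf (\<xi> q) = hopf (\<phi> q)"
    and d: "\<phi> differentiable (at p)" "\<xi> differentiable (at p)"
  shows "fs_form \<xi> p = fs_form \<phi> p"
proof -
  define c where "c q = herm (\<xi> q) (\<phi> q)" for q
  let ?D = "frechet_derivative \<phi> (at p)" and ?E = "frechet_derivative \<xi> (at p)"
  have c: "\<xi> q = c q *s \<phi> q \<and> c q * cnj (c q) = 1" if "q \<in> S" for q
  proof -
    have "\<xi> q \<in> hopf (\<xi> q)" unfolding hopf_def by (auto intro!: exI[of _ 0])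
    then have "\<xi> q \<in> hopf (\<phi> q)"
      using fibre that by simp
    then obtain t where t: "\<xi> q = cis t *s \<phi> q"
      unfolding hopf_def by auto
    then have "c q = cis t"
      using sphere[OF that] by (simp add: c_def herm_simps herm_self)
    then show ?thesis using t by (simp add: cis_cnj cis_mult)
  qed
  have D: "(\<phi> has_derivative ?D) (at p)" and E: "(\<xi> has_derivative ?E) (at p)"
    using d by (simp_all add: frechet_derivative_works)
  define c' where "c' v = herm (\<xi> p) (?D v) + herm (?E v) (\<phi> p)" for v
  have c': "(c has_derivative c') (at p)"
    unfolding c_def c'_def by (rule bounded_bilinear.FDERIV[OF bounded_bilinear_herm E D])
  have "((\<lambda>q. c q *s \<phi> q) has_derivative (\<lambda>v. c p *s ?D v + c' v *s \<phi> p)) (at p)"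
    by (rule bounded_bilinear.FDERIV[OF bounded_bilinear_cscale c' D])
  then have "(\<xi> has_derivative (\<lambda>v. c p *s ?D v + c' v *s \<phi> p)) (at p)"
    by (rule has_derivative_transform_within_open[OF _ S]) (rule c[THEN conjunct1, symmetric])
  then have E': "?E v = c p *s ?D v + c' v *s \<phi> p" for v
    using fun_cong[OF has_derivative_unique[OF E]] by blast
  have n: "herm (\<phi> p) (\<phi> p) = 1"
    using sphere[OF S(2)] by (simp add: herm_self)
  have k: "c p * (x * (cnj (c p) * y)) = x * y" "c p * (cnj (c p) * y) = y" for x y
  proof -
    have "c p * (x * (cnj (c p) * y)) = c p * cnj (c p) * (x * y)"
      "c p * (cnj (c p) * y) = c p * cnj (c p) * y" by (simp_all only: mult_ac)
    then show "c p * (x * (cnj (c p) * y)) = x * y" "c p * (cnj (c p) * y) = y"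
      using c[OF S(2)] by simp_all
  qed
  have "dhopf \<xi> p v = c p *s dhopf \<phi> p v" for v
    unfolding dhopf_def horizontal_def E' c[OF S(2), THEN conjunct1]
    by (simp add: herm_simps n vec_eq_iff algebra_simps k)
  then show ?thesis
    by (intro ext) (simp add: fs_form_def herm_simps algebra_simps k)
qed

text \<open>
  On the rationality condition \<open>c\<^sub>3 C / (2 \<pi>) \<integral>\<^sub>0\<^sup>\<tau> e\<^sup>-\<^sup>3\<^sup>u / (e\<^sup>2\<^sup>u - C) dz \<in> \<rat>\<close> of the theorem about these
  tori: the source prints an additional factor \<open>\<tau>\<close> in front of the integral, which would be
  correct for the mean value of the integrand over a period, but not for the integral. As \<open>z\<close>
  increases by \<open>\<tau>\<close>, the phases of \<open>P\<close> and \<open>Q\<close> increase by \<open>c\<^sub>3 \<integral>\<^sub>0\<^sup>\<tau> e\<^sup>-\<^sup>3\<^sup>u dz\<close> and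
  \<open>c\<^sub>3 \<integral>\<^sub>0\<^sup>\<tau> e\<^sup>-\<^sup>u / (e\<^sup>2\<^sup>u - C) dz\<close>, whose difference is \<open>-c\<^sub>3 C \<integral>\<^sub>0\<^sup>\<tau> e\<^sup>-\<^sup>3\<^sup>u / (e\<^sup>2\<^sup>u - C) dz\<close>.
  If \<open>u\<close> is not constant, a period lattice of rank 3 exists only if this number
  is a rational multiple of \<open>2 \<pi>\<close>, and the theorem therefore states the condition in that form.
\<close>

end

theory Submission
  imports Defs
begin

text \<open>
  The lift \<open>\<psi>\<close> is horizontal and \<open>herm (d\<psi> v) (d\<psi> w) = exp (2 u) * (v \<bullet> w)\<close> is real, which gives the
  Lagrangian and the conformal property together. Both come down to six moment identities
  for the weights \<open>\<gamma>\<^sub>j\<^sup>2\<close>, which say that a 3 by 3 matrix is orthogonal.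

  For H-minimality, expand the Laplacian of \<open>\<psi>\<close> in the frame \<open>\<psi>, \<psi>\<^sub>x, \<psi>\<^sub>y, \<psi>\<^sub>z\<close>. The imaginary parts of
  the coefficients of \<open>\<psi>\<^sub>x, \<psi>\<^sub>y, \<psi>\<^sub>z\<close>, times \<open>exp u\<close>, are \<open>- a exp u\<close>, \<open>- b exp u\<close> and a constant: this
  field has divergence zero. So the first variation along a Hamiltonian field is the
  integral of a divergence of a periodic field over a period box, hence zero.
\<close>

text \<open>The lift is periodic only up to a phase, and a deformation may start at another lift of
  the same map. \<open>fs_form\<close> sees neither, since it depends only on the map into
  projective space: after a time-independent change of phase the deformation starts at
  \<open>\<psi>\<close>, and as \<open>\<psi>\<close> is horizontal, the functions to be integrated
  by parts are values of \<open>fs_form\<close>, hence periodic. The rationality hypotheses allow a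
  rectangular period lattice, so integration by parts takes place on a box, one coordinate at a
  time. The factor exp u comes from the conformal metric: for E^2 times the flat metric in dimension
  3, E^3 times the Laplace-Beltrami operator is the sum of the d_i (E d_i). The normal part of the
  expansion is then the mean curvature, and its zero divergence says that the Lagrangian angle form
  is coclosed. The obstacle is the profile equation. Being of first order, it yields the second
  order equation only where u' is not 0, and u may be constant. Hence the third component of the
  field is shown to be constant, not to vanish.\<close>

abbreviation dirderiv :: "('a::real_normed_vector \<Rightarrow> 'b::real_normed_vector) \<Rightarrow> 'a \<Rightarrow> 'a \<Rightarrow> 'b" where
  "dirderiv f v p \<equiv> frechet_derivative f (at p) v"

subsection \<open>Smooth maps\<close>

lemma dirderiv_eq: "(f has_derivative f') (at x) \<Longrightarrow> dirderiv f v x = f' v"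
  by (metis frechet_derivative_at)

lemma higher_differentiable_on_cong:
  assumes "open S"
  shows "higher_differentiable_on n S f \<Longrightarrow> (\<And>x. x \<in> S \<Longrightarrow> f x = g x) \<Longrightarrow> higher_differentiable_on n S g"
proof (induction n arbitrary: f g)
  case 0
  then show ?case by (simp cong: continuous_on_cong)
next
  case (Suc n)
  have g: "(g has_derivative frechet_derivative f (at x)) (at x)" if "x \<in> S" for x
    using Suc.prems that assms
    by (auto intro: has_derivative_transform_within_open simp: frechet_derivative_works)
  have "higher_differentiable_on n S (dirderiv g v)" for v
  proof (rule Suc.IH)
    show "higher_differentiable_on n S (dirderiv f v)" using Suc.prems by simp
    show "dirderiv f v x = dirderiv g v x" if "x \<in> S" for x
      using dirderiv_eq[OF g[OF that]] by simp
  qed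
  then show ?case using g by (auto simp: differentiable_def)
qed

text \<open>On an open set any formula for the derivative may stand in for
  \<open>frechet_derivative\<close>, which lets the inductions below use explicit
  derivatives.\<close>

lemma higher_differentiable_on_SucI:
  assumes "open S" "\<And>x. x \<in> S \<Longrightarrow> (f has_derivative f' x) (at x)"
    and "\<And>v. higher_differentiable_on n S (\<lambda>x. f' x v)"
  shows "higher_differentiable_on (Suc n) S f"
proof -
  have "higher_differentiable_on n S (dirderiv f v)" for v
    by (rule higher_differentiable_on_cong[OF assms(1) assms(3)[of v]])
      (simp add: dirderiv_eq[OF assms(2)])
  then show ?thesis using assms(2) by (auto simp: differentiable_def)
qed

text \<open>The product rule leaves one factor undifferentiated; its order has to be lowered by one
  before the induction hypothesis for products applies.\<close>

lemma higher_differentiable_on_SucD: "higher_differentiable_on (Suc n) S f \<Longrightarrow> higher_differentiable_on n S f"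
proof (induction n arbitrary: f)
  case 0
  then show ?case
    by (auto intro!: continuous_at_imp_continuous_on differentiable_imp_continuous_within)
next
  case (Suc n)
  then show ?case
    using higher_differentiable_on.simps(2) by metis
qed

lemma higher_differentiable_on_const: "higher_differentiable_on n S (\<lambda>x. c)"
  by (induction n arbitrary: c) auto

lemma higher_differentiable_on_add:
  assumes "open S"
  shows "higher_differentiable_on n S f \<Longrightarrow> higher_differentiable_on n S g \<Longrightarrow>
    higher_differentiable_on n S (\<lambda>x. f x + g x)"
proof (induction n arbitrary: f g)
  case 0
  then show ?case by (simp add: continuous_on_add)
next
  case (Suc n)
  show ?case
  proof (rule higher_differentiable_on_SucI[OF assms])
    show "((\<lambda>x. f x + g x) has_derivative
        (\<lambda>v. frechet_derivative f (at x) v + frechet_derivative g (at x) v)) (at x)" if "x \<in> S" for x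
      using that Suc.prems by (auto intro!: has_derivative_add simp: frechet_derivative_works)
  qed (use Suc in auto)
qed

lemma higher_differentiable_on_bounded_linear:
  assumes "open S" "bounded_linear L"
  shows "higher_differentiable_on n S f \<Longrightarrow> higher_differentiable_on n S (\<lambda>x. L (f x))"
proof (induction n arbitrary: f)
  case 0
  then show ?case using assms(2) by (simp add: bounded_linear.continuous_on)
next
  case (Suc n)
  show ?case
  proof (rule higher_differentiable_on_SucI[OF assms(1)])
    show "((\<lambda>x. L (f x)) has_derivative (\<lambda>v. L (frechet_derivative f (at x) v))) (at x)" if "x \<in> S" for x
      using that Suc.prems
      by (intro bounded_linear.has_derivative[OF assms(2)]) (simp add: frechet_derivative_works)
  qed (use Suc in auto)
qed

lemma higher_differentiable_on_bounded_bilinear: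
  assumes "open S" "bounded_bilinear B"
  shows "higher_differentiable_on n S f \<Longrightarrow> higher_differentiable_on n S g \<Longrightarrow>
    higher_differentiable_on n S (\<lambda>x. B (f x) (g x))"
proof (induction n arbitrary: f g)
  case 0
  then show ?case using assms(2) by (simp add: bounded_bilinear.continuous_on)
next
  case (Suc n)
  show ?case
  proof (rule higher_differentiable_on_SucI[OF assms(1)])
    show "((\<lambda>x. B (f x) (g x)) has_derivative
        (\<lambda>v. B (f x) (frechet_derivative g (at x) v) + B (frechet_derivative f (at x) v) (g x))) (at x)"
      if "x \<in> S" for x
      using that Suc.prems
      by (auto intro!: bounded_bilinear.FDERIV[OF assms(2)] simp: frechet_derivative_works)
    show "higher_differentiable_on n S
        (\<lambda>x. B (f x) (frechet_derivative g (at x) v) + B (frechet_derivative f (at x) v) (g x))" for v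
      using Suc.prems higher_differentiable_on_SucD[OF Suc.prems(1)]
        higher_differentiable_on_SucD[OF Suc.prems(2)]
      by (intro higher_differentiable_on_add Suc.IH assms(1)) auto
  qed
qed

text \<open>The derivative of \<open>f (L x)\<close> in direction \<open>v\<close> is the derivative
  of \<open>f\<close> in direction \<open>L v\<close>, taken at \<open>L x\<close>. This is again a
  composition with \<open>L\<close>, so the induction closes.\<close>

lemma higher_differentiable_on_compose_linear:
  assumes "open S" "bounded_linear L" "L ` S \<subseteq> T"
  shows "higher_differentiable_on n T f \<Longrightarrow> higher_differentiable_on n S (\<lambda>x. f (L x))"
proof (induction n arbitrary: f)
  case 0
  then show ?case
    using assms by (auto intro!: continuous_on_compose2[of T f S L] simp: linear_continuous_on)
next
  case (Suc n)
  show ?case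
  proof (rule higher_differentiable_on_SucI[OF assms(1)])
    fix x assume x: "x \<in> S"
    have "(L has_derivative L) (at x)"
      by (rule bounded_linear_imp_has_derivative[OF assms(2)])
    moreover have "(f has_derivative frechet_derivative f (at (L x))) (at (L x))"
      using Suc.prems x assms(3) by (auto simp: frechet_derivative_works)
    ultimately show "((\<lambda>x. f (L x)) has_derivative (\<lambda>v. frechet_derivative f (at (L x)) (L v))) (at x)"
      by (rule has_derivative_compose)
  qed (use Suc in auto)
qed

lemma smooth_on_higher: "smooth_on S f \<Longrightarrow> higher_differentiable_on n S f"
  by (simp add: smooth_on_def)

lemma smooth_on_dirderiv: "smooth_on S f \<Longrightarrow> smooth_on S (dirderiv f v)"
  unfolding smooth_on_def using higher_differentiable_on.simps(2) by blast

lemma smooth_on_has_derivative: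
  "smooth_on S f \<Longrightarrow> x \<in> S \<Longrightarrow> (f has_derivative frechet_derivative f (at x)) (at x)"
  using smooth_on_higher[of S f 1] by (simp add: frechet_derivative_works)

lemma smooth_on_differentiable: "smooth_on S f \<Longrightarrow> x \<in> S \<Longrightarrow> f differentiable (at x)"
  using smooth_on_has_derivative differentiable_def by blast

lemma smooth_on_continuous: "smooth_on S f \<Longrightarrow> continuous_on S f"
  using smooth_on_higher[of S f 0] by simp

lemma smooth_on_const: "smooth_on S (\<lambda>x. c)"
  by (simp add: smooth_on_def higher_differentiable_on_const)

lemma smooth_on_add: "open S \<Longrightarrow> smooth_on S f \<Longrightarrow> smooth_on S g \<Longrightarrow> smooth_on S (\<lambda>x. f x + g x)"
  by (simp add: smooth_on_def higher_differentiable_on_add)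

lemma smooth_on_bounded_linear:
  "bounded_linear L \<Longrightarrow> open S \<Longrightarrow> smooth_on S f \<Longrightarrow> smooth_on S (\<lambda>x. L (f x))"
  by (simp add: smooth_on_def higher_differentiable_on_bounded_linear)

lemma smooth_on_bounded_bilinear:
  "bounded_bilinear B \<Longrightarrow> open S \<Longrightarrow> smooth_on S f \<Longrightarrow> smooth_on S g \<Longrightarrow> smooth_on S (\<lambda>x. B (f x) (g x))"
  by (simp add: smooth_on_def higher_differentiable_on_bounded_bilinear)

lemmas smooth_on_mult = smooth_on_bounded_bilinear[OF bounded_bilinear_mult]
  and smooth_on_minus = smooth_on_bounded_linear[OF bounded_linear_minus[OF bounded_linear_ident]]
  and smooth_on_herm = smooth_on_bounded_bilinear[OF bounded_bilinear_herm]
  and smooth_on_cscale = smooth_on_bounded_bilinear[OF bounded_bilinear_cscale]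

lemma smooth_on_diff:
  "open S \<Longrightarrow> smooth_on S f \<Longrightarrow> smooth_on S g \<Longrightarrow> smooth_on S (\<lambda>x. f x - g x)"
  using smooth_on_add[OF _ _ smooth_on_minus, of S f g] by simp

lemma smooth_on_sum:
  assumes "open S"
  shows "(\<And>i. i \<in> I \<Longrightarrow> smooth_on S (f i)) \<Longrightarrow> smooth_on S (\<lambda>x. \<Sum>i\<in>I. f i x)"
  using assms by (induction I rule: infinite_finite_induct) (auto intro: smooth_on_const smooth_on_add)

lemma smooth_on_compose_linear:
  "bounded_linear L \<Longrightarrow> open S \<Longrightarrow> L ` S \<subseteq> T \<Longrightarrow> smooth_on T f \<Longrightarrow> smooth_on S (\<lambda>x. f (L x))"
  unfolding smooth_on_def using higher_differentiable_on_compose_linear by blast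

lemma smooth_on_vec_componentwise:
  fixes f :: "'a::real_normed_vector \<Rightarrow> complex ^ 4"
  assumes "open S" "\<And>i. smooth_on S (\<lambda>x. f x $ i)"
  shows "smooth_on S f"
proof -
  have "bounded_linear (axis i :: complex \<Rightarrow> complex ^ 4)" for i
    by (rule bounded_linearI') (simp_all add: vec_eq_iff axis_def)
  then have "smooth_on S (\<lambda>x. \<Sum>i\<in>UNIV. axis i (f x $ i))"
    by (rule smooth_on_sum[OF assms(1) smooth_on_bounded_linear[OF _ assms(1) assms(2)]])
  moreover have "(\<Sum>i\<in>UNIV. axis i (v $ i)) = v" for v :: "complex ^ 4"
    by (simp add: vec_eq_iff axis_def sum.delta if_distrib cong: if_cong)
  ultimately show ?thesis by simp
qed

lemma higher_differentiable_on_real_SucI: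
  assumes "\<And>x. (f has_vector_derivative f' x) (at x)" "higher_differentiable_on n UNIV f'"
  shows "higher_differentiable_on (Suc n) UNIV f"
proof (rule higher_differentiable_on_SucI)
  show "(f has_derivative (\<lambda>v. v *\<^sub>R f' x)) (at x)" for x
    using assms(1) by (simp add: has_vector_derivative_def)
  show "higher_differentiable_on n UNIV (\<lambda>x. v *\<^sub>R f' x)" for v
    by (intro higher_differentiable_on_bounded_linear[OF _ bounded_linear_scaleR_right] assms(2)) simp
qed simp

text \<open>Bootstrapping: if \<open>f\<close> has order \<open>n\<close>, so does its derivative
  \<open>w * f\<close>, and \<open>f\<close> gains an order. This covers \<open>cis\<close>,
  exponentials of the profile, and the profile factors of the lift, whose phases are known only as
  antiderivatives.\<close>

lemma smooth_on_if_linear_ode: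
  fixes f :: "real \<Rightarrow> 'a::real_normed_algebra"
  assumes "\<And>x. (f has_vector_derivative w x * f x) (at x)" "smooth_on UNIV w"
  shows "smooth_on UNIV f"
  unfolding smooth_on_def
proof
  show "higher_differentiable_on n UNIV f" for n
  proof (induction n)
    case 0
    show ?case
      using assms(1) by (auto intro!: continuous_at_imp_continuous_on has_vector_derivative_continuous)
  next
    case (Suc n)
    then show ?case
      using assms smooth_on_higher
      by (intro higher_differentiable_on_real_SucI[of f "\<lambda>x. w x * f x"]
          higher_differentiable_on_bounded_bilinear[OF _ bounded_bilinear_mult]) auto
  qed
qed

text \<open>A bootstrap again: the derivative of the inverse is a product of the inverse itself,
  already of order \<open>n\<close>, and a derivative of \<open>f\<close>.\<close>

lemma smooth_on_inverse:
  fixes f :: "'a::real_normed_vector \<Rightarrow> 'b::real_normed_field"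
  assumes "open S" "smooth_on S f" "\<And>x. x \<in> S \<Longrightarrow> f x \<noteq> 0"
  shows "smooth_on S (\<lambda>x. inverse (f x))"
  unfolding smooth_on_def
proof
  show "higher_differentiable_on n S (\<lambda>x. inverse (f x))" for n
  proof (induction n)
    case 0
    show ?case
      using assms smooth_on_continuous by (auto intro!: continuous_on_inverse)
  next
    case (Suc n)
    note B = higher_differentiable_on_bounded_bilinear[OF assms(1) bounded_bilinear_mult]
    show ?case
    proof (rule higher_differentiable_on_SucI[OF assms(1)])
      show "((\<lambda>x. inverse (f x)) has_derivative
          (\<lambda>v. - (inverse (f x) * dirderiv f v x * inverse (f x)))) (at x)" if "x \<in> S" for x
        using that assms by (intro Deriv.has_derivative_inverse smooth_on_has_derivative[OF assms(2)]) auto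
      have "higher_differentiable_on n S (\<lambda>x. inverse (f x) * dirderiv f v x * inverse (f x))" for v
        by (intro B Suc.IH smooth_on_higher smooth_on_dirderiv assms(2))
      then show "higher_differentiable_on n S (\<lambda>x. - (inverse (f x) * dirderiv f v x * inverse (f x)))" for v
        by (rule higher_differentiable_on_bounded_linear[OF assms(1) bounded_linear_minus[OF bounded_linear_ident]])
    qed
  qed
qed

section \<open>Derivatives along lines and the symmetry of second derivatives\<close>

lemma has_vector_derivative_line:
  assumes "f differentiable (at (p + t *\<^sub>R v))"
  shows "((\<lambda>t. f (p + t *\<^sub>R v)) has_vector_derivative dirderiv f v (p + t *\<^sub>R v)) (at t within U)"
proof -
  have D: "(f has_derivative frechet_derivative f (at (p + t *\<^sub>R v))) (at (p + t *\<^sub>R v))"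
    using assms by (simp add: frechet_derivative_works)
  then have "((\<lambda>t. f (p + t *\<^sub>R v)) has_derivative (\<lambda>h. dirderiv f (h *\<^sub>R v) (p + t *\<^sub>R v))) (at t)"
    by (rule has_derivative_compose[rotated]) (auto intro!: derivative_eq_intros)
  moreover have "dirderiv f (h *\<^sub>R v) (p + t *\<^sub>R v) = h *\<^sub>R dirderiv f v (p + t *\<^sub>R v)" for h
    using D by (simp add: has_derivative_def linear_simps)
  ultimately show ?thesis
    by (simp add: has_vector_derivative_def has_derivative_at_withinI)
qed

text \<open>Schwarz's theorem by integration. The increment of \<open>f\<close> along
  \<open>v\<close> is the integral of its \<open>v\<close>-derivative; differentiating under the
  integral sign along \<open>w\<close>, and then in the upper limit, compares the two mixed
  derivatives. One-sided derivatives at the corner of a small square suffice.\<close>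

lemma dirderiv_commute:
  fixes f :: "'a::real_normed_vector \<Rightarrow> 'b::banach"
  assumes S: "open S" "p \<in> S" and f: "smooth_on S f"
  shows "dirderiv (dirderiv f v) w p = dirderiv (dirderiv f w) v p"
proof -
  define q where "q s t = p + s *\<^sub>R v + t *\<^sub>R w" for s t
  have "\<exists>r>0. \<forall>s\<in>{0..r}. \<forall>t\<in>{0..r}. q s t \<in> S"
  proof -
    obtain e where e: "e > 0" "ball p e \<subseteq> S"
      using S open_contains_ball by blast
    define m where "m = norm v + norm w + 1"
    define r where "r = e / (2 * m)"
    have n: "m > 0" by (simp add: m_def add_nonneg_pos)
    have "q s t \<in> ball p e" if "s \<in> {0..r}" "t \<in> {0..r}" for s t
    proof -
      have "dist p (q s t) = norm (s *\<^sub>R v + t *\<^sub>R w)"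
        by (simp add: q_def dist_norm norm_minus_commute algebra_simps)
      also have "\<dots> \<le> s * norm v + t * norm w"
        using that norm_triangle_ineq[of "s *\<^sub>R v" "t *\<^sub>R w"] by simp
      also have "\<dots> \<le> r * norm v + r * norm w"
        using that by (intro add_mono mult_right_mono) auto
      also have "\<dots> \<le> r * m"
        using that by (simp add: m_def algebra_simps)
      also have "\<dots> < e" using n e(1) by (simp add: r_def)
      finally show ?thesis by simp
    qed
    moreover have "r > 0" using n e(1) by (simp add: r_def)
    ultimately show ?thesis using e(2) by blast
  qed
  then obtain r where r: "r > 0" and qS: "\<And>s t. s \<in> {0..r} \<Longrightarrow> t \<in> {0..r} \<Longrightarrow> q s t \<in> S"
    by blast
  have diff: "h differentiable (at (q s t))"
    if "smooth_on S h" "s \<in> {0..r}" "t \<in> {0..r}" for h :: "'a \<Rightarrow> 'b" and s t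
    using smooth_on_differentiable[OF that(1) qS[OF that(2,3)]] .
  have ds: "((\<lambda>s. h (q s t)) has_vector_derivative dirderiv h v (q s t)) (at s within U)"
    if "smooth_on S h" "s \<in> {0..r}" "t \<in> {0..r}" for h :: "'a \<Rightarrow> 'b" and s t U
    using has_vector_derivative_line[of h "p + t *\<^sub>R w" s v U] diff[OF that]
    by (simp add: q_def algebra_simps)
  have dt: "((\<lambda>t. h (q s t)) has_vector_derivative dirderiv h w (q s t)) (at t within U)"
    if "smooth_on S h" "s \<in> {0..r}" "t \<in> {0..r}" for h :: "'a \<Rightarrow> 'b" and s t U
    using has_vector_derivative_line[of h "p + s *\<^sub>R v" t w U] diff[OF that]
    by (simp add: q_def algebra_simps)
  have cont: "continuous_on ({0..r} \<times> {0..r}) (\<lambda>(t, s). h (q s t))"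
    if "smooth_on S h" for h :: "'a \<Rightarrow> 'b"
    unfolding case_prod_beta
    by (rule continuous_on_compose2[OF smooth_on_continuous[OF that]])
      (use qS in \<open>auto simp: q_def intro!: continuous_intros\<close>)
  have conts: "continuous_on {0..r} (\<lambda>s. h (q s t))"
    if "smooth_on S h" "t \<in> {0..r}" for h :: "'a \<Rightarrow> 'b" and t
    by (rule continuous_on_compose2[OF smooth_on_continuous[OF that(1)]])
      (use qS that in \<open>auto simp: q_def intro!: continuous_intros\<close>)
  let ?vw = "dirderiv (dirderiv f v) w"
  have triv: "at 0 within {0..r} \<noteq> bot"
    using r by (simp add: trivial_limit_within islimpt_Icc)
  have z: "(0::real) \<in> {0..r}" using r by simp
  note smooth = f smooth_on_dirderiv[OF f] smooth_on_dirderiv[OF smooth_on_dirderiv[OF f]]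
  have int: "integral {0..s} (\<lambda>s. ?vw (q s 0)) = dirderiv f w (q s 0) - dirderiv f w (q 0 0)"
    if s: "s \<in> {0..r}" for s
  proof (rule vector_derivative_unique_within[OF triv])
    have "((\<lambda>t. integral (cbox 0 s) (\<lambda>s. dirderiv f v (q s t))) has_vector_derivative
        integral (cbox 0 s) (\<lambda>s. ?vw (q s 0))) (at 0 within {0..r})"
    proof (rule leibniz_rule_vector_derivative)
      show "((\<lambda>t. dirderiv f v (q s' t)) has_vector_derivative ?vw (q s' t)) (at t within {0..r})"
        if "t \<in> {0..r}" "s' \<in> cbox 0 s" for t s'
        using that s by (intro dt smooth) auto
      show "(\<lambda>s. dirderiv f v (q s t)) integrable_on cbox 0 s" if "t \<in> {0..r}" for t
        using that s by (intro integrable_continuous continuous_on_subset[OF conts[OF smooth(2)]]) auto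
      show "continuous_on ({0..r} \<times> cbox 0 s) (\<lambda>(t, s). ?vw (q s t))"
        using s by (intro continuous_on_subset[OF cont[OF smooth(3)]]) auto
    qed (use r in auto)
    then show "((\<lambda>t. integral {0..s} (\<lambda>s. dirderiv f v (q s t))) has_vector_derivative
        integral {0..s} (\<lambda>s. ?vw (q s 0))) (at 0 within {0..r})" by simp
    have eq: "integral {0..s} (\<lambda>s. dirderiv f v (q s t)) = f (q s t) - f (q 0 t)"
      if "t \<in> {0..r}" for t
      using that s
      by (intro integral_unique fundamental_theorem_of_calculus ds smooth) auto
    show "((\<lambda>t. integral {0..s} (\<lambda>s. dirderiv f v (q s t))) has_vector_derivative
        dirderiv f w (q s 0) - dirderiv f w (q 0 0)) (at 0 within {0..r})"
      by (rule has_vector_derivative_transform[where f="\<lambda>t. f (q s t) - f (q 0 t)",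
            OF z eq has_vector_derivative_diff[OF dt[OF f s z] dt[OF f z z]]])
  qed
  have "?vw (q 0 0) = dirderiv (dirderiv f w) v (q 0 0)"
  proof (rule vector_derivative_unique_within[OF triv])
    show "((\<lambda>s. integral {0..s} (\<lambda>s. ?vw (q s 0))) has_vector_derivative ?vw (q 0 0)) (at 0 within {0..r})"
      by (rule integral_has_vector_derivative[OF conts[OF smooth(3) z] z])
    have "((\<lambda>s. dirderiv f w (q s 0) - dirderiv f w (q 0 0)) has_vector_derivative
        dirderiv (dirderiv f w) v (q 0 0)) (at 0 within {0..r})"
      using has_vector_derivative_diff[OF ds[OF smooth(2) z z] has_vector_derivative_const] by simp
    from has_vector_derivative_transform[OF z _ this, of "\<lambda>s. integral {0..s} (\<lambda>s. ?vw (q s 0))"] int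
    show "((\<lambda>s. integral {0..s} (\<lambda>s. ?vw (q s 0))) has_vector_derivative
        dirderiv (dirderiv f w) v (q 0 0)) (at 0 within {0..r})"
      by blast
  qed
  then show ?thesis by (simp add: q_def)
qed


subsection \<open>Integrals of periodic functions\<close>

text \<open>The slab of the shifted box that sticks out beyond the face at height
  \<open>b \<bullet> e\<close> is moved back by one period and fills the gap left at the
  bottom.\<close>

lemma integral_shift_periodic:
  fixes F :: "'a::euclidean_space \<Rightarrow> real"
  assumes e: "e \<in> Basis" and s: "0 \<le> s" "s \<le> b \<bullet> e"
    and cont: "continuous_on UNIV F" and per: "\<And>p. F (p + (b \<bullet> e) *\<^sub>R e) = F p"
  shows "integral (cbox 0 b) (\<lambda>p. F (p + s *\<^sub>R e)) = integral (cbox 0 b) F"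
proof -
  let ?T = "b \<bullet> e"
  have int: "F integrable_on cbox c d" for c d
    using cont continuous_on_subset integrable_continuous by blast
  have box: "x \<in> cbox c d \<longleftrightarrow> (c \<bullet> e \<le> x \<bullet> e \<and> x \<bullet> e \<le> d \<bullet> e) \<and>
      (\<forall>i\<in>Basis - {e}. c \<bullet> i \<le> x \<bullet> i \<and> x \<bullet> i \<le> d \<bullet> i)" for x c d :: 'a
    unfolding mem_box using e by blast
  have eqI: "cbox c d \<inter> {x. R (x \<bullet> e)} = cbox c' d'"
    if "\<And>i. i \<in> Basis - {e} \<Longrightarrow> c \<bullet> i = c' \<bullet> i \<and> d \<bullet> i = d' \<bullet> i"
      and "\<And>y. (c \<bullet> e \<le> y \<and> y \<le> d \<bullet> e) \<and> R y \<longleftrightarrow> c' \<bullet> e \<le> y \<and> y \<le> d' \<bullet> e" for c d c' d' R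
  proof (rule set_eqI)
    show "x \<in> cbox c d \<inter> {x. R (x \<bullet> e)} \<longleftrightarrow> x \<in> cbox c' d'" for x
      using that(1) that(2)[of "x \<bullet> e"] unfolding Int_iff mem_Collect_eq box by auto
  qed
  have ei: "e \<bullet> e = 1" "\<And>i. i \<in> Basis - {e} \<Longrightarrow> e \<bullet> i = 0"
    using e by (auto simp: inner_Basis)
  have "integral (cbox 0 b) (\<lambda>p. F (p + s *\<^sub>R e)) = integral (cbox (s *\<^sub>R e) (b + s *\<^sub>R e)) F"
    using integral_shift_cbox[of "s *\<^sub>R e" "s *\<^sub>R e" "b + s *\<^sub>R e" F] by simp
  also have "\<dots> = integral (cbox (s *\<^sub>R e) (b + s *\<^sub>R e) \<inter> {x. x \<bullet> e \<le> ?T}) F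
      + integral (cbox (s *\<^sub>R e) (b + s *\<^sub>R e) \<inter> {x. x \<bullet> e \<ge> ?T}) F"
    by (rule integral_split[OF int e])
  also have "cbox (s *\<^sub>R e) (b + s *\<^sub>R e) \<inter> {x. x \<bullet> e \<le> ?T} = cbox (s *\<^sub>R e) b"
    by (rule eqI) (use s in \<open>auto simp: ei inner_left_distrib\<close>)
  also have "cbox (s *\<^sub>R e) (b + s *\<^sub>R e) \<inter> {x. x \<bullet> e \<ge> ?T} = cbox (?T *\<^sub>R e) (b + s *\<^sub>R e)"
    by (rule eqI) (use s in \<open>auto simp: ei inner_left_distrib\<close>)
  also have "integral (cbox (?T *\<^sub>R e) (b + s *\<^sub>R e)) F = integral (cbox 0 (b + (s - ?T) *\<^sub>R e)) F"
    using integral_shift_cbox[of "?T *\<^sub>R e" "?T *\<^sub>R e" "b + s *\<^sub>R e" F]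
    by (simp add: per algebra_simps)
  also have "cbox 0 (b + (s - ?T) *\<^sub>R e) = cbox 0 b \<inter> {x. x \<bullet> e \<le> s}"
    by (rule eqI[symmetric]) (use s in \<open>auto simp: ei inner_left_distrib\<close>)
  also have "cbox (s *\<^sub>R e) b = cbox 0 b \<inter> {x. x \<bullet> e \<ge> s}"
    by (rule eqI[symmetric]) (use s in \<open>auto simp: ei inner_left_distrib\<close>)
  also have "integral (cbox 0 b \<inter> {x. x \<bullet> e \<ge> s}) F + integral (cbox 0 b \<inter> {x. x \<bullet> e \<le> s}) F
      = integral (cbox 0 b) F"
    using integral_split[OF int e, of 0 b s] by simp
  finally show ?thesis .
qed

text \<open>The integral of the shifted function over the box does not depend on the shift. Its
  derivative at shift 0 is therefore 0, and under the integral sign it is the integral of the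
  directional derivative.\<close>

lemma integral_dirderiv_periodic:
  fixes F :: "'a::euclidean_space \<Rightarrow> real"
  assumes e: "e \<in> Basis" and b: "0 < b \<bullet> e"
    and F: "smooth_on UNIV F" and per: "\<And>p. F (p + (b \<bullet> e) *\<^sub>R e) = F p"
  shows "(dirderiv F e has_integral 0) (cbox 0 b)"
proof -
  let ?U = "{0 .. b \<bullet> e}"
  have contF: "continuous_on UNIV F" and contD: "continuous_on UNIV (dirderiv F e)"
    using F by (auto intro: smooth_on_continuous smooth_on_dirderiv)
  have D: "((\<lambda>s. integral (cbox 0 b) (\<lambda>p. F (p + s *\<^sub>R e))) has_vector_derivative
      integral (cbox 0 b) (\<lambda>p. dirderiv F e (p + 0 *\<^sub>R e))) (at 0 within ?U)"
  proof (rule leibniz_rule_vector_derivative)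
    show "((\<lambda>s. F (p + s *\<^sub>R e)) has_vector_derivative dirderiv F e (p + s *\<^sub>R e)) (at s within ?U)" for s p
      by (rule has_vector_derivative_line[OF smooth_on_differentiable[OF F]]) simp
  next
    show "(\<lambda>p. F (p + s *\<^sub>R e)) integrable_on cbox 0 b" for s
      by (intro integrable_continuous continuous_on_compose2[OF contF] continuous_intros) auto
    show "continuous_on (?U \<times> cbox 0 b) (\<lambda>(s, p). dirderiv F e (p + s *\<^sub>R e))"
      unfolding case_prod_beta
      by (intro continuous_on_compose2[OF contD] continuous_intros) auto
  qed (use b in auto)
  have C: "((\<lambda>s. integral (cbox 0 b) (\<lambda>p. F (p + s *\<^sub>R e))) has_vector_derivative 0) (at 0 within ?U)"
    by (rule has_vector_derivative_transform[where f="\<lambda>_. integral (cbox 0 b) F",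
          OF _ _ has_vector_derivative_const])
      (use b integral_shift_periodic[OF e _ _ contF per] in auto)
  have "integral (cbox 0 b) (\<lambda>p. dirderiv F e (p + 0 *\<^sub>R e)) = 0"
    by (rule vector_derivative_unique_within[OF _ D C])
      (use b in \<open>simp add: trivial_limit_within islimpt_Icc\<close>)
  moreover have "dirderiv F e integrable_on cbox 0 b"
    using contD continuous_on_subset integrable_continuous by blast
  ultimately show ?thesis by (simp add: has_integral_integrable_integral)
qed

subsection \<open>First variation of the volume\<close>

lemma herm_commute: "cnj (herm u v) = herm v u"
  by (simp add: herm_def mult.commute)

lemma fs_form_eq:
  assumes "\<phi> p \<in> sphere 0 1"
  shows "fs_form \<phi> p v w = herm (dirderiv \<phi> v p) (dirderiv \<phi> w p)
    - herm (dirderiv \<phi> v p) (\<phi> p) * cnj (herm (dirderiv \<phi> w p) (\<phi> p))"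
  using assms
  by (simp add: fs_form_def dhopf_def horizontal_def herm_simps herm_self herm_commute
      bounded_bilinear.diff_right[OF bounded_bilinear_herm] algebra_simps)

lemma has_derivative_slice:
  assumes "f differentiable (at (t, p))"
  shows "((\<lambda>p. f (t, p)) has_derivative (\<lambda>v. dirderiv f (0, v) (t, p))) (at p)"
proof -
  have "((\<lambda>p. (t, p)) has_derivative (\<lambda>v. (0, v))) (at p)"
    by (auto intro!: derivative_eq_intros)
  moreover have "(f has_derivative frechet_derivative f (at (t, p))) (at (t, p))"
    using assms by (simp add: frechet_derivative_works)
  ultimately show ?thesis by (rule has_derivative_compose)
qed

lemmas dirderiv_slice = dirderiv_eq[OF has_derivative_slice]

lemma smooth_on_slice_zero:
  assumes "\<epsilon> > 0" "smooth_on ({-\<epsilon><..<\<epsilon>} \<times> UNIV) f"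
  shows "smooth_on UNIV (\<lambda>p. f (0 :: real, p))"
  by (rule smooth_on_compose_linear[OF _ _ _ assms(2)])
    (use assms in \<open>auto intro!: bounded_linear_Pair bounded_linear_zero bounded_linear_ident\<close>)

lemma has_vector_derivative_time:
  assumes "smooth_on ({-\<epsilon><..<\<epsilon>} \<times> UNIV) f" "t \<in> {-\<epsilon><..<\<epsilon>}"
  shows "((\<lambda>t. f (t, p)) has_vector_derivative dirderiv f (1, 0) (t, p)) (at t within U)"
  using has_vector_derivative_line[of f "(0, p)" t "(1, 0)" U] smooth_on_differentiable[OF assms(1), of "(t, p)"]
    assms(2) by simp

text \<open>Jacobi's formula at \<open>r\<close> times the identity, whose adjugate in dimension 3
  is \<open>r\<^sup>2\<close> times the identity.\<close>

lemma det_variation: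
  fixes G :: "3 \<Rightarrow> 3 \<Rightarrow> real \<Rightarrow> real"
  assumes "\<And>i j. (G i j has_real_derivative G' i j) (at t)"
    and "\<And>i j. G i j t = (if i = j then r else 0)"
  shows "((\<lambda>t. det (\<chi> i j. G i j t)) has_real_derivative r\<^sup>2 * (\<Sum>i\<in>UNIV. G' i i)) (at t)"
  unfolding det_3 vec_lambda_beta sum_3
  by (rule derivative_eq_intros assms(1) refl)+ (simp add: assms(2) power2_eq_square algebra_simps)

text \<open>The vertical parts of the derivatives enter the metric quadratically and vanish at time
  0 by horizontality, so they do not affect the first variation. Conformality makes the determinant
  \<open>E p ^ 6\<close> and its derivative \<open>E p ^ 4\<close> times twice a trace; the division
  by \<open>2 * E p ^ 3\<close> that comes from the square root leaves the single factor
  \<open>E p\<close>.\<close>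

lemma torus_volume_has_derivative:
  fixes \<Psi> :: "real \<times> (real ^ 3) \<Rightarrow> complex ^ 4"
  defines "\<psi> \<equiv> \<lambda>p. \<Psi> (0, p)" and "W \<equiv> \<lambda>p. dirderiv \<Psi> (1, 0) (0, p)"
  assumes \<epsilon>: "\<epsilon> > 0" and smooth: "smooth_on ({-\<epsilon><..<\<epsilon>} \<times> UNIV) \<Psi>"
    and sphere: "\<And>t p. t \<in> {-\<epsilon><..<\<epsilon>} \<Longrightarrow> \<Psi> (t, p) \<in> sphere 0 1"
    and hor: "\<And>p v. herm (dirderiv \<psi> v p) (\<psi> p) = 0"
    and conf: "\<And>p v w. herm (dirderiv \<psi> v p) (dirderiv \<psi> w p) = of_real ((E p)\<^sup>2 * (v \<bullet> w))"
    and E: "\<And>p. E p > 0"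
    and box: "(\<lambda>s. A *v s) ` {s. \<forall>i. 0 \<le> s $ i \<and> s $ i \<le> 1} = cbox a b"
  shows "((\<lambda>t. torus_volume A (\<lambda>p. \<Psi> (t, p))) has_real_derivative
    integral (cbox a b) (\<lambda>p. E p * (\<Sum>i\<in>UNIV. Re (herm (dirderiv W (axis i 1) p) (dirderiv \<psi> (axis i 1) p)))))
    (at 0)"
proof -
  let ?S = "{-\<epsilon><..<\<epsilon>} \<times> (UNIV :: (real ^ 3) set)"
  have S: "open ?S" by (simp add: open_Times)
  have mem: "(t, p) \<in> ?S \<longleftrightarrow> t \<in> {-\<epsilon><..<\<epsilon>}" for t p by auto
  have z: "0 \<in> {-\<epsilon><..<\<epsilon>}" using \<epsilon> by simp
  define e where "e i = (axis i 1 :: real ^ 3)" for i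
  define D where "D i = dirderiv \<Psi> (0, e i)" for i
  define H where "H i q = herm (D i q) (\<Psi> q)" for i q
  define G where "G i j q = Re (herm (D i q) (D j q) - H i q * cnj (H j q))" for i j q
  define \<Delta> where "\<Delta> q = det (\<chi> i j. G i j q)" for q
  have sD: "smooth_on ?S (D i)" for i
    unfolding D_def by (rule smooth_on_dirderiv[OF smooth])
  have sH: "smooth_on ?S (H i)" for i
    unfolding H_def by (rule smooth_on_herm[OF S sD smooth])
  have sG: "smooth_on ?S (G i j)" for i j
    unfolding G_def
    by (rule smooth_on_bounded_linear[OF bounded_linear_Re S smooth_on_diff[OF S smooth_on_herm[OF S sD sD]
          smooth_on_mult[OF S sH smooth_on_bounded_linear[OF bounded_linear_cnj S sH]]]])
  have s\<Delta>: "smooth_on ?S \<Delta>"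
    unfolding \<Delta>_def det_3 vec_lambda_beta by (intro smooth_on_add smooth_on_diff smooth_on_mult sG S)
  have slice: "dirderiv (\<lambda>p. \<Psi> (t, p)) (e i) p = D i (t, p)" if "t \<in> {-\<epsilon><..<\<epsilon>}" for t p i
    unfolding D_def by (rule dirderiv_slice[OF smooth_on_differentiable[OF smooth]]) (use that mem in blast)
  have fs: "Re (fs_form (\<lambda>p. \<Psi> (t, p)) p (e i) (e j)) = G i j (t, p)" if "t \<in> {-\<epsilon><..<\<epsilon>}" for t p i j
    using fs_form_eq[of "\<lambda>p. \<Psi> (t, p)" p "e i" "e j"] sphere[OF that, of p]
    by (simp add: slice[OF that] G_def H_def)
  have D0: "D i (0, p) = dirderiv \<psi> (e i) p" for i p
    using slice[OF z] by (simp add: \<psi>_def)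
  have H0: "H i (0, p) = 0" for i p
    using hor by (simp add: H_def D0 \<psi>_def)
  have G0: "G i j (0, p) = (if i = j then (E p)\<^sup>2 else 0)" for i j p
    by (simp add: G_def H0 D0 conf e_def inner_axis_axis)
  \<comment> \<open>Exchanging time and space derivatives turns the velocity of a tangent vector
    into the space derivative of the variation field.\<close>
  have W': "dirderiv W (e i) p = dirderiv (D i) (1, 0) (0, p)" for i p
  proof -
    have "dirderiv W (e i) p = dirderiv (dirderiv \<Psi> (1, 0)) (0, e i) (0, p)"
      unfolding W_def
      by (rule dirderiv_slice[OF smooth_on_differentiable[OF smooth_on_dirderiv[OF smooth]]]) (use z mem in blast)
    also have "\<dots> = dirderiv (D i) (1, 0) (0, p)"
      unfolding D_def by (rule dirderiv_commute[OF S _ smooth]) (use z mem in blast)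
    finally show ?thesis .
  qed
  have G': "((\<lambda>t. G i i (t, p)) has_real_derivative
      2 * Re (herm (dirderiv W (e i) p) (dirderiv \<psi> (e i) p))) (at 0)" for i p
  proof -
    note dD = has_vector_derivative_time[OF sD z] and dH = has_vector_derivative_time[OF sH z]
    have 1: "((\<lambda>t. herm (D i (t, p)) (D i (t, p))) has_vector_derivative
        herm (D i (0, p)) (dirderiv (D i) (1, 0) (0, p)) + herm (dirderiv (D i) (1, 0) (0, p)) (D i (0, p))) (at 0)"
      by (rule bounded_bilinear.has_vector_derivative[OF bounded_bilinear_herm dD dD])
    have 2: "((\<lambda>t. H i (t, p) * cnj (H i (t, p))) has_vector_derivative
        H i (0, p) * cnj (dirderiv (H i) (1, 0) (0, p)) + dirderiv (H i) (1, 0) (0, p) * cnj (H i (0, p))) (at 0)"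
      by (rule has_vector_derivative_mult[OF dH
            bounded_linear.has_vector_derivative[OF bounded_linear_cnj dH]])
    have "Re (herm x y + herm y x) = 2 * Re (herm y x)" for x y
      using arg_cong[OF herm_commute[of y x], of Re] by simp
    then show ?thesis
      using bounded_linear.has_vector_derivative[OF bounded_linear_Re has_vector_derivative_diff[OF 1 2]]
      by (simp only: G_def has_real_derivative_iff_has_vector_derivative H0 W' D0[symmetric]) simp
  qed
  have Gt: "((\<lambda>t. G i j (t, p)) has_real_derivative dirderiv (G i j) (1, 0) (0, p)) (at 0)" for i j p
    using has_vector_derivative_time[OF sG z] by (simp add: has_real_derivative_iff_has_vector_derivative)
  have \<Delta>t: "((\<lambda>t. \<Delta> (t, p)) has_real_derivative dirderiv \<Delta> (1, 0) (t, p)) (at t within U)"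
    if "t \<in> {-\<epsilon><..<\<epsilon>}" for t p U
    using has_vector_derivative_time[OF s\<Delta> that] by (simp add: has_real_derivative_iff_has_vector_derivative)
  have \<Delta>0: "\<Delta> (0, p) = (E p ^ 3)\<^sup>2" for p
    by (simp add: \<Delta>_def det_3 G0)
  have \<Delta>': "dirderiv \<Delta> (1, 0) (0, p) = ((E p)\<^sup>2)\<^sup>2 *
      (\<Sum>i\<in>UNIV. 2 * Re (herm (dirderiv W (e i) p) (dirderiv \<psi> (e i) p)))" for p
  proof -
    have "dirderiv \<Delta> (1, 0) (0, p) = ((E p)\<^sup>2)\<^sup>2 * (\<Sum>i\<in>UNIV. dirderiv (G i i) (1, 0) (0, p))"
      using DERIV_unique[OF \<Delta>t[OF z] det_variation[OF Gt G0, folded \<Delta>_def]] .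
    then show ?thesis using DERIV_unique[OF Gt G'] by simp
  qed
  \<comment> \<open>The square root has to be differentiable on a whole time interval common to all
    points; compactness of the box provides one on which the determinant stays positive.\<close>
  obtain \<delta> where \<delta>: "\<delta> > 0" "\<delta> < \<epsilon>" and pos: "\<And>t p. t \<in> {-\<delta>..\<delta>} \<Longrightarrow> p \<in> cbox a b \<Longrightarrow> \<Delta> (t, p) > 0"
  proof -
    let ?B = "?S \<inter> \<Delta> -` {0<..}"
    have "open ?B"
      by (rule continuous_open_preimage[OF smooth_on_continuous[OF s\<Delta>] S open_greaterThan])
    moreover have "compact ({0} \<times> cbox a b)"
      by (intro compact_Times compact_cbox) simp
    moreover have "{0} \<times> cbox a b \<subseteq> ?B"
      using \<epsilon> E[THEN less_imp_neq] by (auto simp: \<Delta>0)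
    ultimately obtain d where d: "d > 0" "(\<Union>q\<in>{0} \<times> cbox a b. ball q d) \<subseteq> ?B"
      using compact_subset_open_imp_ball_epsilon_subset by blast
    show thesis
    proof
      show "min d \<epsilon> / 2 > 0" "min d \<epsilon> / 2 < \<epsilon>" using d \<epsilon> by auto
      fix t p assume t: "t \<in> {- (min d \<epsilon> / 2)..min d \<epsilon> / 2}" and p: "p \<in> cbox a b"
      have "\<bar>t\<bar> < d"
        using t d(1) min.cobounded1[of d \<epsilon>] unfolding atLeastAtMost_iff by linarith
      then have "dist (0, p) (t, p) < d"
        by (simp add: dist_Pair_Pair dist_real_def)
      then show "\<Delta> (t, p) > 0" using d(2) p by fastforce
    qed
  qed
  have \<delta>\<epsilon>: "{-\<delta>..\<delta>} \<subseteq> {-\<epsilon><..<\<epsilon>}" using \<delta> by auto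
  define g where "g t p = dirderiv \<Delta> (1, 0) (t, p) / (2 * sqrt (\<Delta> (t, p)))" for t p
  have cont: "continuous_on ({-\<delta>..\<delta>} \<times> cbox a b) f" if "smooth_on ?S f" for f :: "_ \<Rightarrow> real"
    by (rule continuous_on_subset[OF smooth_on_continuous[OF that]]) (use \<delta>\<epsilon> in auto)
  have contp: "continuous_on (cbox a b) (\<lambda>p. f (t, p))" if "smooth_on ?S f" "t \<in> {-\<delta>..\<delta>}"
    for f :: "_ \<Rightarrow> real" and t
    by (rule continuous_on_compose2[OF cont[OF that(1)]]) (use that in \<open>auto intro!: continuous_intros\<close>)
  have "((\<lambda>t. integral (cbox a b) (\<lambda>p. sqrt (\<Delta> (t, p)))) has_real_derivative integral (cbox a b) (g 0))
      (at 0 within {-\<delta>..\<delta>})"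
  proof (rule leibniz_rule_field_derivative)
    show "((\<lambda>t. sqrt (\<Delta> (t, p))) has_real_derivative g t p) (at t within {-\<delta>..\<delta>})"
      if "t \<in> {-\<delta>..\<delta>}" "p \<in> cbox a b" for t p
      using pos[OF that] \<Delta>t[of t p] that(1) \<delta>\<epsilon>
      by (auto intro!: derivative_eq_intros simp: g_def field_simps)
    show "(\<lambda>p. sqrt (\<Delta> (t, p))) integrable_on cbox a b" if "t \<in> {-\<delta>..\<delta>}" for t
      by (intro integrable_continuous continuous_on_real_sqrt contp[OF s\<Delta> that])
    show "continuous_on ({-\<delta>..\<delta>} \<times> cbox a b) (\<lambda>(t, p). g t p)"
      unfolding g_def case_prod_beta prod.collapse
      by (intro continuous_on_divide continuous_on_mult continuous_on_const continuous_on_real_sqrt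
          cont s\<Delta> smooth_on_dirderiv) (use pos in fastforce)
  qed (use \<delta> in auto)
  then have "((\<lambda>t. integral (cbox a b) (\<lambda>p. sqrt (\<Delta> (t, p)))) has_real_derivative integral (cbox a b) (g 0)) (at 0)"
    using \<delta> by (simp add: at_within_Icc_at)
  then have "((\<lambda>t. torus_volume A (\<lambda>p. \<Psi> (t, p))) has_real_derivative integral (cbox a b) (g 0)) (at 0)"
    by (rule has_field_derivative_transform_within_open[OF _ open_greaterThanLessThan z])
      (simp add: torus_volume_def box fs[unfolded e_def] \<Delta>_def)
  moreover have "g 0 = (\<lambda>p. E p * (\<Sum>i\<in>UNIV. Re (herm (dirderiv W (e i) p) (dirderiv \<psi> (e i) p))))"
  proof
    fix p
    have "sqrt (\<Delta> (0, p)) = E p ^ 3"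
      using E[of p] by (intro real_sqrt_unique) (simp_all add: \<Delta>0)
    then show "g 0 p = E p * (\<Sum>i\<in>UNIV. Re (herm (dirderiv W (e i) p) (dirderiv \<psi> (e i) p)))"
      using E[of p] by (simp add: g_def \<Delta>' power2_eq_square power3_eq_cube flip: sum_distrib_left)
  qed
  ultimately show ?thesis by (simp add: e_def)
qed

section \<open>Changing the lift of a deformation\<close>

lemma hopf_cis: "hopf (cis s *s q) = hopf q"
proof (intro set_eqI iffI)
  show "x \<in> hopf q" if "x \<in> hopf (cis s *s q)" for x
    using that by (auto simp: hopf_def vector_smult_assoc cis_mult)
  show "x \<in> hopf (cis s *s q)" if x: "x \<in> hopf q" for x
  proof -
    from x obtain t where "x = cis t *s q" by (auto simp: hopf_def)
    then have "x = cis (t - s) *s (cis s *s q)" by (simp add: vector_smult_assoc cis_mult)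
    then show ?thesis by (auto simp: hopf_def)
  qed
qed

lemma hopf_eqD:
  assumes "hopf x = hopf y"
  obtains t where "x = cis t *s y"
proof -
  have "x \<in> hopf x" unfolding hopf_def by (auto intro!: exI[of _ 0])
  then show thesis using assms that by (auto simp: hopf_def)
qed

text \<open>Multiplying a deformation by a phase that does not depend on time makes it start at the given lift.\<close>

lemma hamiltonian_deformation_regauge:
  assumes \<Phi>: "hamiltonian_deformation A \<psi> \<epsilon> \<Phi>"
    and \<psi>: "smooth_on UNIV \<psi>" "\<And>p. \<psi> p \<in> sphere 0 1"
  obtains \<Psi> where "hamiltonian_deformation A \<psi> \<epsilon> \<Psi>" "\<And>p. \<Psi> (0, p) = \<psi> p"
    "\<And>t. t \<in> {-\<epsilon><..<\<epsilon>} \<Longrightarrow> torus_volume A (\<lambda>p. \<Psi> (t, p)) = torus_volume A (\<lambda>p. \<Phi> (t, p))"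
proof -
  let ?I = "{-\<epsilon><..<\<epsilon>}" and ?S = "{-\<epsilon><..<\<epsilon>} \<times> (UNIV :: (real ^ 3) set)"
  have \<epsilon>: "\<epsilon> > 0" and s\<Phi>: "smooth_on ?S \<Phi>"
    and \<Phi>1: "\<And>t p. t \<in> ?I \<Longrightarrow> \<Phi> (t, p) \<in> sphere 0 1"
    and per: "\<And>t p l. t \<in> ?I \<Longrightarrow> l \<in> lattice_of A \<Longrightarrow> hopf (\<Phi> (t, p + l)) = hopf (\<Phi> (t, p))"
    and \<Phi>0: "\<And>p. hopf (\<Phi> (0, p)) = hopf (\<psi> p)"
    using \<Phi> by (auto simp: hamiltonian_deformation_def)
  have S: "open ?S" by (simp add: open_Times)
  have z: "0 \<in> ?I" using \<epsilon> by simp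
  \<comment> \<open>The Hermitian product extracts the phase between the two lifts as a smooth
    function of \<open>p\<close>, whereas the angles \<open>s\<close> obtained below are chosen
    point by point.\<close>
  define c where "c p = herm (\<psi> p) (\<Phi> (0, p))" for p
  define \<Psi> where "\<Psi> q = c (snd q) *s \<Phi> q" for q
  have c: "\<exists>s. c p = cis s \<and> \<psi> p = c p *s \<Phi> (0, p)" for p
  proof -
    obtain s where s: "\<psi> p = cis s *s \<Phi> (0, p)" using hopf_eqD[OF \<Phi>0[symmetric]] .
    then have "c p = cis s" using \<Phi>1[OF z, of p] by (simp add: c_def herm_simps herm_self)
    with s show ?thesis by auto
  qed
  have fibre: "hopf (\<Psi> q) = hopf (\<Phi> q)" for q
    using c[of "snd q"] by (auto simp: \<Psi>_def hopf_cis)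
  have norm: "\<Psi> (t, p) \<in> sphere 0 1" if "t \<in> ?I" for t p
  proof -
    have "herm (\<Psi> (t, p)) (\<Psi> (t, p)) = herm (\<Phi> (t, p)) (\<Phi> (t, p))"
      using c[of p] by (auto simp: \<Psi>_def herm_simps cis_cnj cis_mult mult.assoc[symmetric])
    then have "(norm (\<Psi> (t, p)))\<^sup>2 = (norm (\<Phi> (t, p)))\<^sup>2"
      unfolding herm_self of_real_eq_iff .
    then show ?thesis using \<Phi>1[OF that, of p] by (simp add: power2_eq_1_iff)
  qed
  have sc: "smooth_on UNIV c"
    unfolding c_def by (rule smooth_on_herm[OF open_UNIV \<psi>(1) smooth_on_slice_zero[OF \<epsilon> s\<Phi>]])
  have s\<Psi>: "smooth_on ?S \<Psi>"
    unfolding \<Psi>_def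
    by (rule smooth_on_cscale[OF S smooth_on_compose_linear[OF bounded_linear_snd S _ sc] s\<Phi>]) simp
  have diff: "f differentiable (at (t, p))" if "smooth_on ?S f" "t \<in> ?I" for f :: "_ \<Rightarrow> complex ^ 4" and t p
    using smooth_on_differentiable[OF that(1)] that(2) by simp
  have slice_diff: "(\<lambda>p. f (t, p)) differentiable (at p)"
    if "smooth_on ?S f" "t \<in> ?I" for f :: "_ \<Rightarrow> complex ^ 4" and t p
    using has_derivative_slice[OF diff[OF that]] unfolding differentiable_def by blast
  have vol: "torus_volume A (\<lambda>p. \<Psi> (t, p)) = torus_volume A (\<lambda>p. \<Phi> (t, p))" if t: "t \<in> ?I" for t
  proof -
    have "fs_form (\<lambda>p. \<Psi> (t, p)) p = fs_form (\<lambda>p. \<Phi> (t, p)) p" for p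
      by (rule fs_form_cong[OF open_UNIV UNIV_I \<Phi>1[OF t] fibre slice_diff[OF s\<Phi> t] slice_diff[OF s\<Psi> t]])
    then show ?thesis by (simp add: torus_volume_def)
  qed
  have fs: "fs_form \<Psi> (0, p) = fs_form \<Phi> (0, p)" for p
    by (rule fs_form_cong[OF S _ _ fibre diff[OF s\<Phi> z] diff[OF s\<Psi> z]]) (use z \<Phi>1 in auto)
  have "hamiltonian_deformation A \<psi> \<epsilon> \<Psi>"
    using \<Phi> s\<Psi> norm fibre fs by (simp add: hamiltonian_deformation_def)
  moreover have "\<Psi> (0, p) = \<psi> p" for p
    using c[of p] by (auto simp: \<Psi>_def)
  ultimately show thesis using vol that by blast
qed

section \<open>Rectangular lattices and periodicity of the form\<close>

lemma diagonal_mult_vec: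
  fixes T :: "3 \<Rightarrow> real"
  shows "(\<chi> i j. if i = j then T i else 0) *v x = (\<chi> i. T i * x $ i)"
  by (simp add: matrix_vector_mult_def vec_eq_iff if_distrib[of "\<lambda>a. a * _"] sum.delta' cong: if_cong)

lemma diagonal_box:
  fixes T :: "3 \<Rightarrow> real"
  assumes "\<And>i. T i > 0"
  shows "(\<lambda>s. (\<chi> i j. if i = j then T i else 0) *v s) ` {s. \<forall>i. 0 \<le> s $ i \<and> s $ i \<le> 1}
    = cbox 0 (\<chi> i. T i)"
proof (intro set_eqI iffI)
  fix x assume "x \<in> cbox 0 (\<chi> i. T i)"
  then have "x = (\<chi> i j. if i = j then T i else 0) *v (\<chi> i. x $ i / T i)"
    and "\<forall>i. 0 \<le> x $ i / T i \<and> x $ i / T i \<le> 1"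
    using assms[THEN less_imp_neq] assms
    by (auto simp: diagonal_mult_vec vec_eq_iff mem_box_cart less_imp_le)
  then show "x \<in> (\<lambda>s. (\<chi> i j. if i = j then T i else 0) *v s) ` {s. \<forall>i. 0 \<le> s $ i \<and> s $ i \<le> 1}"
    by (intro image_eqI[where x="\<chi> i. x $ i / T i"]) simp_all
qed (use assms in \<open>auto simp: diagonal_mult_vec mem_box_cart less_imp_le mult_left_le\<close>)

lemma axis_in_diagonal_lattice:
  fixes T :: "3 \<Rightarrow> real"
  shows "T j *\<^sub>R axis j 1 \<in> lattice_of (\<chi> i j. if i = j then T i else 0)"
  unfolding lattice_of_def diagonal_mult_vec
  by (rule image_eqI[where x="axis j 1"]) (simp_all add: vec_eq_iff axis_def)

text \<open>The translated map is a second lift of the same map into projective space, so the form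
  is periodic although the lift is periodic only up to a phase.\<close>

lemma fs_form_shift:
  assumes S: "open S" "p \<in> S" "p + l \<in> S"
    and \<phi>: "\<And>q. q \<in> S \<Longrightarrow> \<phi> q \<in> sphere 0 1" "\<And>q. q \<in> S \<Longrightarrow> hopf (\<phi> (q + l)) = hopf (\<phi> q)"
    and d: "\<And>q. q \<in> S \<Longrightarrow> \<phi> differentiable (at q)"
  shows "fs_form \<phi> (p + l) = fs_form \<phi> p"
proof -
  have D: "((\<lambda>q. \<phi> (q + l)) has_derivative frechet_derivative \<phi> (at (p + l))) (at p)"
  proof -
    have "((\<lambda>q. q + l) has_derivative (\<lambda>v. v)) (at p)" by (auto intro!: derivative_eq_intros)
    moreover have "(\<phi> has_derivative frechet_derivative \<phi> (at (p + l))) (at (p + l))"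
      using d[OF S(3)] by (simp add: frechet_derivative_works)
    ultimately show ?thesis by (rule has_derivative_compose)
  qed
  have "fs_form \<phi> (p + l) = fs_form (\<lambda>q. \<phi> (q + l)) p"
    by (intro ext) (simp add: fs_form_def dhopf_def dirderiv_eq[OF D])
  also have "\<dots> = fs_form \<phi> p"
  proof (rule fs_form_cong[OF S(1,2) \<phi> d[OF S(2)]])
    show "(\<lambda>q. \<phi> (q + l)) differentiable (at p)"
      unfolding differentiable_def by (rule exI, rule D)
  qed
  finally show ?thesis .
qed

text \<open>With \<open>W\<close> the variation field and \<open>h\<close> its Hamiltonian, the derivative of the volume
  is the integral of the divergence of the periodic field \<open>E * Re (herm W (d\<^sub>i \<psi>)) - m\<^sub>i * h\<close>. The
  coefficients \<open>m\<^sub>i / E\<close> are the components of the Lagrangian angle form.\<close>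

lemma hamiltonian_minimalI:
  fixes \<psi> :: "real ^ 3 \<Rightarrow> complex ^ 4" and E \<mu> :: "real ^ 3 \<Rightarrow> real" and m :: "3 \<Rightarrow> real ^ 3 \<Rightarrow> real"
    and T :: "3 \<Rightarrow> real"
  defines "A \<equiv> \<chi> i j. if i = j then T i else 0"
  assumes \<psi>: "smooth_on UNIV \<psi>" "\<And>p. \<psi> p \<in> sphere 0 1"
    and hor: "\<And>p v. herm (dirderiv \<psi> v p) (\<psi> p) = 0"
    and conf: "\<And>p v w. herm (dirderiv \<psi> v p) (dirderiv \<psi> w p) = of_real ((E p)\<^sup>2 * (v \<bullet> w))"
    and E: "smooth_on UNIV E" "\<And>p. E p > 0" and m: "\<And>i. smooth_on UNIV (m i)"
    and laplacian: "\<And>p. of_real (E p) *s (\<Sum>i\<in>UNIV. dirderiv (dirderiv \<psi> (axis i 1)) (axis i 1) p) =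
      of_real (\<mu> p) *s \<psi> p +
      (\<Sum>i\<in>UNIV. (of_real (- dirderiv E (axis i 1) p) + \<i> * of_real (m i p)) *s dirderiv \<psi> (axis i 1) p)"
    and div: "\<And>p. (\<Sum>i\<in>UNIV. dirderiv (m i) (axis i 1) p) = 0"
    and T: "\<And>i. T i > 0"
    and per: "\<And>p i. E (p + T i *\<^sub>R axis i 1) = E p" "\<And>p i. m i (p + T i *\<^sub>R axis i 1) = m i p"
  shows "hamiltonian_minimal A \<psi>"
  unfolding hamiltonian_minimal_def
proof (intro allI impI)
  fix \<epsilon> \<Phi> assume "hamiltonian_deformation A \<psi> \<epsilon> \<Phi>"
  then obtain \<Psi> where \<Psi>: "hamiltonian_deformation A \<psi> \<epsilon> \<Psi>" and \<Psi>0: "\<And>p. \<Psi> (0, p) = \<psi> p"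
    and vol: "\<And>t. t \<in> {-\<epsilon><..<\<epsilon>} \<Longrightarrow> torus_volume A (\<lambda>p. \<Psi> (t, p)) = torus_volume A (\<lambda>p. \<Phi> (t, p))"
    using hamiltonian_deformation_regauge[OF _ \<psi>] by metis
  let ?I = "{-\<epsilon><..<\<epsilon>}" and ?S = "{-\<epsilon><..<\<epsilon>} \<times> (UNIV :: (real ^ 3) set)"
  define e where "e i = (axis i 1 :: real ^ 3)" for i
  have \<epsilon>: "\<epsilon> > 0" and s\<Psi>: "smooth_on ?S \<Psi>"
    and \<Psi>1: "\<And>t p. t \<in> ?I \<Longrightarrow> \<Psi> (t, p) \<in> sphere 0 1"
    and \<Psi>per: "\<And>t p l. t \<in> ?I \<Longrightarrow> l \<in> lattice_of A \<Longrightarrow> hopf (\<Psi> (t, p + l)) = hopf (\<Psi> (t, p))"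
    using \<Psi> by (auto simp: hamiltonian_deformation_def)
  obtain h where h: "smooth_on UNIV h" "\<And>p l. l \<in> lattice_of A \<Longrightarrow> h (p + l) = h p"
    and dh: "\<And>p v. Im (fs_form \<Psi> (0, p) (1, 0) (0, v)) = dirderiv h v p"
    using \<Psi> by (auto simp: hamiltonian_deformation_def)
  have S: "open ?S" by (simp add: open_Times)
  have z: "0 \<in> ?I" using \<epsilon> by simp
  define W where "W p = dirderiv \<Psi> (1, 0) (0, p)" for p
  define r where "r i p = Re (herm (W p) (dirderiv \<psi> (e i) p))" for i p
  have sW: "smooth_on UNIV W"
    unfolding W_def by (rule smooth_on_slice_zero[OF \<epsilon> smooth_on_dirderiv[OF s\<Psi>]])
  have s\<psi>: "smooth_on UNIV (dirderiv \<psi> (e i))" for i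
    by (rule smooth_on_dirderiv[OF \<psi>(1)])
  have slice: "dirderiv \<Psi> (0, v) (0, p) = dirderiv \<psi> v p" for v p
    using dirderiv_slice[OF smooth_on_differentiable[OF s\<Psi>], of 0 p v] z by (simp add: \<Psi>0)
  have fs: "fs_form \<Psi> (0, p) (1, 0) (0, v) = herm (W p) (dirderiv \<psi> v p)" for p v
    using fs_form_eq[of \<Psi> "(0, p)" "(1, 0)" "(0, v)"] \<Psi>1[OF z, of p] by (simp add: slice W_def hor \<Psi>0)
  have imW: "Im (herm (W p) (dirderiv \<psi> v p)) = dirderiv h v p" for p v
    using dh fs by simp
  \<comment> \<open>The deformation stays on the unit sphere, so \<open>W\<close> is tangent to it.
    This removes the \<open>\<psi>\<close> term of the Laplacian below.\<close>
  have reW: "Re (herm (W p) (\<psi> p)) = 0" for p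
  proof -
    have "((\<lambda>t. herm (\<Psi> (t, p)) (\<Psi> (t, p))) has_vector_derivative herm (\<psi> p) (W p) + herm (W p) (\<psi> p)) (at 0)"
      using bounded_bilinear.has_vector_derivative[OF bounded_bilinear_herm
          has_vector_derivative_time[OF s\<Psi> z] has_vector_derivative_time[OF s\<Psi> z]]
      by (simp add: \<Psi>0 W_def)
    moreover have "((\<lambda>t. herm (\<Psi> (t, p)) (\<Psi> (t, p))) has_vector_derivative 0) (at 0)"
      by (rule has_vector_derivative_transform_within_open[OF has_vector_derivative_const[of 1] open_greaterThanLessThan z])
        (use \<Psi>1 in \<open>simp add: herm_self\<close>)
    ultimately have "herm (\<psi> p) (W p) + herm (W p) (\<psi> p) = 0"
      by (rule vector_derivative_unique_at)
    then have "Re (cnj (herm (W p) (\<psi> p)) + herm (W p) (\<psi> p)) = 0" by (simp add: herm_commute)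
    then show ?thesis by simp
  qed
  define F where "F i p = E p * r i p - m i p * h p" for i p
  have sr: "smooth_on UNIV (r i)" for i
    unfolding r_def
    by (rule smooth_on_bounded_linear[OF bounded_linear_Re open_UNIV smooth_on_herm[OF open_UNIV sW s\<psi>]])
  have sF: "smooth_on UNIV (F i)" for i
    unfolding F_def by (intro smooth_on_diff smooth_on_mult sr E m h open_UNIV)
  \<comment> \<open>Neither \<open>W\<close> nor the derivatives of \<open>\<psi>\<close> need be
    periodic, but their Hermitian product is a value of \<open>fs_form\<close>, which is.\<close>
  have perF: "F i (p + T i *\<^sub>R e i) = F i p" for i p
  proof -
    have l: "T i *\<^sub>R e i \<in> lattice_of A"
      unfolding A_def e_def by (rule axis_in_diagonal_lattice)
    have "fs_form \<Psi> ((0, p) + (0, T i *\<^sub>R e i)) = fs_form \<Psi> (0, p)"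
      by (rule fs_form_shift[OF S]) (use \<epsilon> \<Psi>1 \<Psi>per l smooth_on_differentiable[OF s\<Psi>] in auto)
    then have "r i (p + T i *\<^sub>R e i) = r i p"
      by (simp add: r_def flip: fs)
    then show ?thesis
      using per h(2)[OF l] by (simp add: F_def e_def)
  qed
  have dr: "dirderiv (r i) v p =
      Re (herm (W p) (dirderiv (dirderiv \<psi> (e i)) v p)) + Re (herm (dirderiv W v p) (dirderiv \<psi> (e i) p))" for i v p
  proof (rule dirderiv_eq)
    have "(W has_derivative frechet_derivative W (at p)) (at p)"
      and "(dirderiv \<psi> (e i) has_derivative frechet_derivative (dirderiv \<psi> (e i)) (at p)) (at p)"
      using sW s\<psi> smooth_on_has_derivative by blast+
    from bounded_linear.has_derivative[OF bounded_linear_Re bounded_bilinear.FDERIV[OF bounded_bilinear_herm this]]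
    show "(r i has_derivative (\<lambda>v. Re (herm (W p) (dirderiv (dirderiv \<psi> (e i)) v p)) +
        Re (herm (dirderiv W v p) (dirderiv \<psi> (e i) p)))) (at p)"
      by (simp add: r_def[abs_def])
  qed
  have dF: "dirderiv (F i) v p = E p * dirderiv (r i) v p + dirderiv E v p * r i p
      - (m i p * dirderiv h v p + dirderiv (m i) v p * h p)" for i v p
    unfolding F_def
    by (rule dirderiv_eq) (intro has_derivative_diff has_derivative_mult smooth_on_has_derivative[OF _ UNIV_I] E m h sr)
  let ?g = "\<lambda>p. E p * (\<Sum>i\<in>UNIV. Re (herm (dirderiv W (e i) p) (dirderiv \<psi> (e i) p)))"
  \<comment> \<open>The hypothesis on the Laplacian is a formula for the sum of the
    \<open>i\<close>-th derivatives of \<open>E p *\<^sub>R dirderiv \<psi> (e i) p\<close>. In its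
    product with \<open>W\<close> the \<open>\<psi>\<close> term drops out, the derivatives of
    \<open>E\<close> cancel, and the factor \<open>\<i>\<close> turns real parts into imaginary
    ones, that is, into derivatives of \<open>h\<close>. The term \<open>m i p * h p\<close> in
    \<open>F\<close> compensates these, because \<open>m\<close> has divergence zero.\<close>
  have sum_F: "(\<Sum>i\<in>UNIV. dirderiv (F i) (e i) p) = ?g p" for p
  proof -
    have sum_right: "herm w (\<Sum>i\<in>UNIV. f i) = (\<Sum>i\<in>UNIV. herm w (f i))" for w and f :: "3 \<Rightarrow> _"
      by (rule linear_sum[OF bounded_linear.linear[OF bounded_bilinear.bounded_linear_right[OF bounded_bilinear_herm]]])
    have "E p * (\<Sum>i\<in>UNIV. Re (herm (W p) (dirderiv (dirderiv \<psi> (e i)) (e i) p)))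
        = Re (herm (W p) (of_real (E p) *s (\<Sum>i\<in>UNIV. dirderiv (dirderiv \<psi> (e i)) (e i) p)))"
      by (simp add: herm_simps sum_right)
    also have "\<dots> = (\<Sum>i\<in>UNIV. m i p * dirderiv h (e i) p - dirderiv E (e i) p * r i p)"
    proof -
      have "Re (herm (W p) (of_real (\<mu> p) *s \<psi> p)) = 0"
        by (simp add: herm_simps reW)
      moreover have "Re (herm (W p) ((of_real (- x) + \<i> * of_real y) *s dirderiv \<psi> (e i) p))
          = y * dirderiv h (e i) p - x * r i p" for x y i
        unfolding herm_simps(4) by (simp add: imW r_def)
      ultimately show ?thesis
        by (simp only: laplacian[folded e_def] herm_add_right sum_right plus_complex.sel Re_sum add_0)
    qed
    finally have "E p * (\<Sum>i\<in>UNIV. Re (herm (W p) (dirderiv (dirderiv \<psi> (e i)) (e i) p)))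
        = (\<Sum>i\<in>UNIV. m i p * dirderiv h (e i) p - dirderiv E (e i) p * r i p)" .
    moreover have "(\<Sum>i\<in>UNIV. dirderiv (m i) (e i) p * h p) = 0"
      using div by (simp add: e_def flip: sum_distrib_right)
    ultimately show ?thesis
      by (simp add: dF dr sum.distrib sum_subtractf distrib_left flip: sum_distrib_left)
  qed
  have "((\<lambda>p. \<Sum>i\<in>UNIV. dirderiv (F i) (e i) p) has_integral (\<Sum>i\<in>(UNIV::3 set). 0)) (cbox 0 (\<chi> i. T i))"
  proof (rule has_integral_sum)
    fix i :: 3
    have "e i \<in> Basis" and "(\<chi> i. T i) \<bullet> e i = T i"
      by (simp_all add: e_def axis_in_Basis_iff inner_axis)
    then show "(dirderiv (F i) (e i) has_integral 0) (cbox 0 (\<chi> i. T i))"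
      using T perF sF by (intro integral_dirderiv_periodic) simp_all
  qed simp
  then have int: "integral (cbox 0 (\<chi> i. T i)) ?g = 0"
    by (simp add: sum_F integral_unique)
  have "((\<lambda>t. torus_volume A (\<lambda>p. \<Psi> (t, p))) has_real_derivative integral (cbox 0 (\<chi> i. T i)) ?g) (at 0)"
    using torus_volume_has_derivative[OF \<epsilon> s\<Psi> \<Psi>1, of E A 0 "\<chi> i. T i"] hor conf E(2) diagonal_box[OF T]
    by (simp add: \<Psi>0 A_def e_def flip: W_def)
  then have "((\<lambda>t. torus_volume A (\<lambda>p. \<Psi> (t, p))) has_real_derivative 0) (at 0)"
    using int by simp
  then show "((\<lambda>t. torus_volume A (\<lambda>p. \<Phi> (t, p))) has_real_derivative 0) (at 0)"
    by (rule has_field_derivative_transform_within_open[OF _ open_greaterThanLessThan z vol])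
qed

subsection \<open>The cubic and its weights\<close>

lemma vector_4:
  "(vector [w, x, y, z] :: 'a::zero ^ 4) $ 1 = w"
  "(vector [w, x, y, z] :: 'a::zero ^ 4) $ 2 = x"
  "(vector [w, x, y, z] :: 'a::zero ^ 4) $ 3 = y"
  "(vector [w, x, y, z] :: 'a::zero ^ 4) $ 4 = z"
  by (simp_all add: vector_def)

lemma cubic_vieta:
  fixes a B c x y z :: real
  assumes "x ^ 3 + a * x\<^sup>2 - B * x + c = 0" "y ^ 3 + a * y\<^sup>2 - B * y + c = 0" "z ^ 3 + a * z\<^sup>2 - B * z + c = 0"
    and "x \<noteq> y" "x \<noteq> z" "y \<noteq> z"
  shows "a = - (x + y + z)" "B = - (x * y + x * z + y * z)" "c = - (x * y * z)"
proof -
  have "(x - y) * (x\<^sup>2 + x * y + y\<^sup>2 + a * (x + y) - B) = 0"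
    and "(x - z) * (x\<^sup>2 + x * z + z\<^sup>2 + a * (x + z) - B) = 0"
    using assms(1-3) by algebra+
  then have 1: "x\<^sup>2 + x * y + y\<^sup>2 + a * (x + y) - B = 0" and 2: "x\<^sup>2 + x * z + z\<^sup>2 + a * (x + z) - B = 0"
    using assms by auto
  then have "(y - z) * (x + y + z + a) = 0" by algebra
  then show a: "a = - (x + y + z)" using assms by simp
  show "B = - (x * y + x * z + y * z)" using 1 a by algebra
  then show "c = - (x * y * z)" using assms(1) a by algebra
qed

text \<open>Clearing the denominator of \<beta> leaves a quartic in \<alpha> that is the cubic times
  \<open>\<alpha> - 2 * c\<^sub>1\<close>. The identity gives the value of the flat Laplacian in x
  and y on the phase with frequencies \<alpha> and \<beta>: the factor
  \<open>- 2 * C + a * \<alpha> + b * \<beta>\<close>.\<close>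

lemma root_norm:
  fixes a b c\<^sub>1 c\<^sub>2 C B \<alpha> \<beta> :: real
  assumes C: "C = a * c\<^sub>1 + b * c\<^sub>2 + 2 * c\<^sub>1\<^sup>2 + 2 * c\<^sub>2\<^sup>2"
    and B: "B = 2 * c\<^sub>1 * a + 3 * c\<^sub>1\<^sup>2 + c\<^sub>2 * b + 3 * c\<^sub>2\<^sup>2"
    and root: "\<alpha> ^ 3 + a * \<alpha>\<^sup>2 - B * \<alpha> + c\<^sub>1 * C = 0" and ne: "\<alpha> \<noteq> c\<^sub>1"
    and \<beta>: "\<beta> = c\<^sub>2 * \<alpha> / (\<alpha> - c\<^sub>1)"
  shows "\<alpha>\<^sup>2 + \<beta>\<^sup>2 = 2 * C - a * \<alpha> - b * \<beta>"
proof -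
  have 1: "\<beta> * (\<alpha> - c\<^sub>1) = c\<^sub>2 * \<alpha>" using ne \<beta> by simp
  have "(\<alpha> - c\<^sub>1)\<^sup>2 * (\<alpha>\<^sup>2 + \<beta>\<^sup>2 - (2 * C - a * \<alpha> - b * \<beta>)) =
      (\<alpha> - c\<^sub>1)\<^sup>2 * (\<alpha>\<^sup>2 - 2 * C + a * \<alpha>) + (\<beta> * (\<alpha> - c\<^sub>1))\<^sup>2 + b * (\<beta> * (\<alpha> - c\<^sub>1)) * (\<alpha> - c\<^sub>1)"
    by (simp add: algebra_simps power2_eq_square)
  also have "\<dots> = (\<alpha> - 2 * c\<^sub>1) * (\<alpha> ^ 3 + a * \<alpha>\<^sup>2 - B * \<alpha> + c\<^sub>1 * C)"
    unfolding 1 C B by (simp add: algebra_simps power2_eq_square power3_eq_cube)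
  finally show ?thesis using root ne by simp
qed

text \<open>The roots give pairwise orthogonal vectors \<open>(sqrt C, \<alpha>\<^sub>j, \<beta>\<^sub>j)\<close>: after clearing denominators this
  follows from the value \<open>- c\<^sub>1 c\<^sub>2\<^sup>2\<close> of the cubic at \<open>c\<^sub>1\<close>.\<close>

lemma root_orthogonal:
  fixes a b c\<^sub>1 c\<^sub>2 C B x y z \<beta>\<^sub>x \<beta>\<^sub>y :: real
  assumes C: "C = a * c\<^sub>1 + b * c\<^sub>2 + 2 * c\<^sub>1\<^sup>2 + 2 * c\<^sub>2\<^sup>2" "C > 0"
    and B: "B = 2 * c\<^sub>1 * a + 3 * c\<^sub>1\<^sup>2 + c\<^sub>2 * b + 3 * c\<^sub>2\<^sup>2"
    and roots: "x ^ 3 + a * x\<^sup>2 - B * x + c\<^sub>1 * C = 0" "y ^ 3 + a * y\<^sup>2 - B * y + c\<^sub>1 * C = 0"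
      "z ^ 3 + a * z\<^sup>2 - B * z + c\<^sub>1 * C = 0"
    and distinct: "x \<noteq> y" "x \<noteq> z" "y \<noteq> z" and ne: "x \<noteq> c\<^sub>1" "y \<noteq> c\<^sub>1" "z \<noteq> c\<^sub>1"
    and \<beta>: "\<beta>\<^sub>x = c\<^sub>2 * x / (x - c\<^sub>1)" "\<beta>\<^sub>y = c\<^sub>2 * y / (y - c\<^sub>1)"
  shows "C + x * y + \<beta>\<^sub>x * \<beta>\<^sub>y = 0"
proof -
  note V = cubic_vieta[OF roots distinct]
  have p: "(x - c\<^sub>1) * (y - c\<^sub>1) * (z - c\<^sub>1) = c\<^sub>1 * c\<^sub>2\<^sup>2"
  proof -
    have "(x - c\<^sub>1) * (y - c\<^sub>1) * (z - c\<^sub>1) = - (c\<^sub>1 ^ 3 + a * c\<^sub>1\<^sup>2 - B * c\<^sub>1 + c\<^sub>1 * C)"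
      using V by algebra
    also have "\<dots> = c\<^sub>1 * c\<^sub>2\<^sup>2"
      unfolding C B by (simp add: algebra_simps power2_eq_square power3_eq_cube)
    finally show ?thesis .
  qed
  then have "c\<^sub>1 \<noteq> 0" using ne by auto
  then have z: "z \<noteq> 0" using V(3) C(2) by auto
  have b: "\<beta>\<^sub>x * (x - c\<^sub>1) = c\<^sub>2 * x" "\<beta>\<^sub>y * (y - c\<^sub>1) = c\<^sub>2 * y" using ne \<beta> by simp_all
  \<comment> \<open>By Vieta \<open>c\<^sub>1 * C = - (x * y * z)\<close>. The factor
    \<open>z\<close> thus turns \<open>C + x * y\<close> into \<open>C * (z - c\<^sub>1)\<close> and
    completes the product evaluated in \<open>p\<close>.\<close>
  have "z * (C + x * y) = C * (z - c\<^sub>1)" using V(3) by algebra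
  then have "z * (x - c\<^sub>1) * (y - c\<^sub>1) * (C + x * y + \<beta>\<^sub>x * \<beta>\<^sub>y) =
      C * ((x - c\<^sub>1) * (y - c\<^sub>1) * (z - c\<^sub>1)) + (\<beta>\<^sub>x * (x - c\<^sub>1)) * (\<beta>\<^sub>y * (y - c\<^sub>1)) * z"
    by algebra
  also have "\<dots> = 0" unfolding p b using V(3) by algebra
  finally show ?thesis using z ne by simp
qed

text \<open>The \<open>\<gamma>\<^sub>j\<close> are the inverse lengths of these vectors (in particular the radicands are positive), so
  they scale them to an orthogonal matrix; the sums are the relations between its columns.\<close>

lemma weighted_orthogonality:
  fixes C \<alpha>\<^sub>1 \<alpha>\<^sub>2 \<alpha>\<^sub>3 \<beta>\<^sub>1 \<beta>\<^sub>2 \<beta>\<^sub>3 \<gamma>\<^sub>1 \<gamma>\<^sub>2 \<gamma>\<^sub>3 :: real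
  assumes C: "C > 0"
    and orth: "C + \<alpha>\<^sub>1 * \<alpha>\<^sub>2 + \<beta>\<^sub>1 * \<beta>\<^sub>2 = 0" "C + \<alpha>\<^sub>1 * \<alpha>\<^sub>3 + \<beta>\<^sub>1 * \<beta>\<^sub>3 = 0" "C + \<alpha>\<^sub>2 * \<alpha>\<^sub>3 + \<beta>\<^sub>2 * \<beta>\<^sub>3 = 0"
    and distinct: "\<alpha>\<^sub>1 \<noteq> \<alpha>\<^sub>2" "\<alpha>\<^sub>1 \<noteq> \<alpha>\<^sub>3" "\<alpha>\<^sub>2 \<noteq> \<alpha>\<^sub>3"
    and \<gamma>: "\<gamma>\<^sub>1 = sqrt ((C + \<alpha>\<^sub>2 * \<alpha>\<^sub>3) / (C * (\<alpha>\<^sub>1 - \<alpha>\<^sub>2) * (\<alpha>\<^sub>1 - \<alpha>\<^sub>3)))"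
      "\<gamma>\<^sub>2 = sqrt ((C + \<alpha>\<^sub>1 * \<alpha>\<^sub>3) / (C * (\<alpha>\<^sub>2 - \<alpha>\<^sub>1) * (\<alpha>\<^sub>2 - \<alpha>\<^sub>3)))"
      "\<gamma>\<^sub>3 = sqrt ((C + \<alpha>\<^sub>1 * \<alpha>\<^sub>2) / (C * (\<alpha>\<^sub>3 - \<alpha>\<^sub>1) * (\<alpha>\<^sub>3 - \<alpha>\<^sub>2)))"
  shows "\<gamma>\<^sub>1\<^sup>2 + \<gamma>\<^sub>2\<^sup>2 + \<gamma>\<^sub>3\<^sup>2 = 1 / C"
    "\<gamma>\<^sub>1\<^sup>2 * \<alpha>\<^sub>1 + \<gamma>\<^sub>2\<^sup>2 * \<alpha>\<^sub>2 + \<gamma>\<^sub>3\<^sup>2 * \<alpha>\<^sub>3 = 0"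
    "\<gamma>\<^sub>1\<^sup>2 * \<beta>\<^sub>1 + \<gamma>\<^sub>2\<^sup>2 * \<beta>\<^sub>2 + \<gamma>\<^sub>3\<^sup>2 * \<beta>\<^sub>3 = 0"
    "\<gamma>\<^sub>1\<^sup>2 * \<alpha>\<^sub>1\<^sup>2 + \<gamma>\<^sub>2\<^sup>2 * \<alpha>\<^sub>2\<^sup>2 + \<gamma>\<^sub>3\<^sup>2 * \<alpha>\<^sub>3\<^sup>2 = 1"
    "\<gamma>\<^sub>1\<^sup>2 * \<beta>\<^sub>1\<^sup>2 + \<gamma>\<^sub>2\<^sup>2 * \<beta>\<^sub>2\<^sup>2 + \<gamma>\<^sub>3\<^sup>2 * \<beta>\<^sub>3\<^sup>2 = 1"
    "\<gamma>\<^sub>1\<^sup>2 * \<alpha>\<^sub>1 * \<beta>\<^sub>1 + \<gamma>\<^sub>2\<^sup>2 * \<alpha>\<^sub>2 * \<beta>\<^sub>2 + \<gamma>\<^sub>3\<^sup>2 * \<alpha>\<^sub>3 * \<beta>\<^sub>3 = 0"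
proof -
  have sqrt_sq: "(sqrt ((C + y * z) / (C * (x - y) * (x - z))))\<^sup>2 * (C + x\<^sup>2 + \<beta>x\<^sup>2) = 1"
    if "C + x * y + \<beta>x * \<beta>y = 0" "C + x * z + \<beta>x * \<beta>z = 0" "C + y * z + \<beta>y * \<beta>z = 0" "x \<noteq> y" "x \<noteq> z"
    for x y z \<beta>x \<beta>y \<beta>z
  proof -
    have pos: "C + x\<^sup>2 + \<beta>x\<^sup>2 > 0" using C by (simp add: add_pos_nonneg)
    \<comment> \<open>The first two relations give \<open>(C + x * y) * (C + x * z) =
      \<beta>x\<^sup>2 * (\<beta>y * \<beta>z)\<close>, and the third replaces
      \<open>\<beta>y * \<beta>z\<close> by \<open>- (C + y * z)\<close>. This identifies the
      radicand as the inverse of a positive number.\<close>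
    have "(C + y * z) * (C + x\<^sup>2 + \<beta>x\<^sup>2) = C * (x - y) * (x - z)" using that(1-3) by algebra
    then have "(C + y * z) / (C * (x - y) * (x - z)) = 1 / (C + x\<^sup>2 + \<beta>x\<^sup>2)"
      using pos that(4,5) C by (simp add: frac_eq_eq)
    then show ?thesis using pos by simp
  qed
  have n: "\<gamma>\<^sub>1\<^sup>2 * (C + \<alpha>\<^sub>1\<^sup>2 + \<beta>\<^sub>1\<^sup>2) = 1" "\<gamma>\<^sub>2\<^sup>2 * (C + \<alpha>\<^sub>2\<^sup>2 + \<beta>\<^sub>2\<^sup>2) = 1" "\<gamma>\<^sub>3\<^sup>2 * (C + \<alpha>\<^sub>3\<^sup>2 + \<beta>\<^sub>3\<^sup>2) = 1"
    unfolding \<gamma>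
    by (rule sqrt_sq[of _ _ _ \<beta>\<^sub>2 _ \<beta>\<^sub>3] sqrt_sq[of _ _ _ \<beta>\<^sub>1 _ \<beta>\<^sub>3] sqrt_sq[of _ _ _ \<beta>\<^sub>1 _ \<beta>\<^sub>2];
        use orth distinct in \<open>simp add: algebra_simps\<close>)+
  define M :: "real ^ 3 ^ 3" where "M = vector [vector [sqrt C * \<gamma>\<^sub>1, \<gamma>\<^sub>1 * \<alpha>\<^sub>1, \<gamma>\<^sub>1 * \<beta>\<^sub>1],
    vector [sqrt C * \<gamma>\<^sub>2, \<gamma>\<^sub>2 * \<alpha>\<^sub>2, \<gamma>\<^sub>2 * \<beta>\<^sub>2], vector [sqrt C * \<gamma>\<^sub>3, \<gamma>\<^sub>3 * \<alpha>\<^sub>3, \<gamma>\<^sub>3 * \<beta>\<^sub>3]]"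
  have sq: "sqrt C * sqrt C = C" using C by simp
  have off: "sqrt C * x * (sqrt C * y) + x * \<alpha> * (y * \<alpha>') + x * \<beta> * (y * \<beta>') = x * y * (C + \<alpha> * \<alpha>' + \<beta> * \<beta>')"
    for x y \<alpha> \<alpha>' \<beta> \<beta>'
  proof -
    have "sqrt C * x * (sqrt C * y) = sqrt C * sqrt C * (x * y)" by (simp only: mult_ac)
    then show ?thesis unfolding sq by (simp add: algebra_simps)
  qed
  have orth': "C + \<alpha>\<^sub>2 * \<alpha>\<^sub>1 + \<beta>\<^sub>2 * \<beta>\<^sub>1 = 0" "C + \<alpha>\<^sub>3 * \<alpha>\<^sub>1 + \<beta>\<^sub>3 * \<beta>\<^sub>1 = 0" "C + \<alpha>\<^sub>3 * \<alpha>\<^sub>2 + \<beta>\<^sub>3 * \<beta>\<^sub>2 = 0"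
    using orth by (simp_all add: mult.commute)
  have "M ** transpose M = mat 1"
    unfolding vec_eq_iff forall_3
    by (simp add: M_def matrix_matrix_mult_def transpose_def mat_def sum_3 off orth orth' n[unfolded power2_eq_square])
  \<comment> \<open>A one-sided inverse of a square matrix is two-sided: orthonormal rows give
    orthonormal columns.\<close>
  then have "transpose M ** M = mat 1" by (simp add: matrix_left_right_inverse)
  then have "(transpose M ** M) $ i $ j = (if i = j then 1 else 0)" for i j
    by (simp add: mat_def)
  note E = this[of 1 1] this[of 1 2] this[of 1 3] this[of 2 2] this[of 3 3] this[of 2 3]
  note E' = E[unfolded M_def matrix_matrix_mult_def transpose_def sum_3, simplified]
  have C': "sqrt C > 0" using C by simp
  have "C * (\<gamma>\<^sub>1\<^sup>2 + \<gamma>\<^sub>2\<^sup>2 + \<gamma>\<^sub>3\<^sup>2) = 1" using E'(1) sq by algebra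
  then show "\<gamma>\<^sub>1\<^sup>2 + \<gamma>\<^sub>2\<^sup>2 + \<gamma>\<^sub>3\<^sup>2 = 1 / C" using C by (simp add: field_simps)
  have "sqrt C * (\<gamma>\<^sub>1\<^sup>2 * \<alpha>\<^sub>1 + \<gamma>\<^sub>2\<^sup>2 * \<alpha>\<^sub>2 + \<gamma>\<^sub>3\<^sup>2 * \<alpha>\<^sub>3) = 0" using E'(2) by algebra
  then show "\<gamma>\<^sub>1\<^sup>2 * \<alpha>\<^sub>1 + \<gamma>\<^sub>2\<^sup>2 * \<alpha>\<^sub>2 + \<gamma>\<^sub>3\<^sup>2 * \<alpha>\<^sub>3 = 0" using C' by simp
  have "sqrt C * (\<gamma>\<^sub>1\<^sup>2 * \<beta>\<^sub>1 + \<gamma>\<^sub>2\<^sup>2 * \<beta>\<^sub>2 + \<gamma>\<^sub>3\<^sup>2 * \<beta>\<^sub>3) = 0" using E'(3) by algebra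
  then show "\<gamma>\<^sub>1\<^sup>2 * \<beta>\<^sub>1 + \<gamma>\<^sub>2\<^sup>2 * \<beta>\<^sub>2 + \<gamma>\<^sub>3\<^sup>2 * \<beta>\<^sub>3 = 0" using C' by simp
  show "\<gamma>\<^sub>1\<^sup>2 * \<alpha>\<^sub>1\<^sup>2 + \<gamma>\<^sub>2\<^sup>2 * \<alpha>\<^sub>2\<^sup>2 + \<gamma>\<^sub>3\<^sup>2 * \<alpha>\<^sub>3\<^sup>2 = 1" using E'(4) by algebra
  show "\<gamma>\<^sub>1\<^sup>2 * \<beta>\<^sub>1\<^sup>2 + \<gamma>\<^sub>2\<^sup>2 * \<beta>\<^sub>2\<^sup>2 + \<gamma>\<^sub>3\<^sup>2 * \<beta>\<^sub>3\<^sup>2 = 1" using E'(5) by algebra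
  show "\<gamma>\<^sub>1\<^sup>2 * \<alpha>\<^sub>1 * \<beta>\<^sub>1 + \<gamma>\<^sub>2\<^sup>2 * \<alpha>\<^sub>2 * \<beta>\<^sub>2 + \<gamma>\<^sub>3\<^sup>2 * \<alpha>\<^sub>3 * \<beta>\<^sub>3 = 0" using E'(6) by algebra
qed

subsection \<open>Periods\<close>

lemma common_denominator:
  assumes "finite R" "R \<subseteq> \<rat>"
  obtains N :: int where "N > 0" "\<And>x. x \<in> R \<Longrightarrow> of_int N * (x :: real) \<in> \<int>"
proof -
  have "\<exists>N :: int. N > 0 \<and> (\<forall>x\<in>R. of_int N * x \<in> \<int>)"
    using assms
  proof (induction R rule: finite_induct)
    case empty
    show ?case by (intro exI[of _ 1]) simp
  next
    case (insert x R)
    then obtain N :: int where N: "N > 0" "\<forall>x\<in>R. of_int N * x \<in> \<int>" by auto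
    obtain p q :: int where q: "q > 0" "x = of_int p / of_int q"
      using insert.prems Rats_cases' by blast
    have "of_int (N * q) * y \<in> \<int>" if "y \<in> R" for y
    proof -
      have "of_int q * (of_int N * y) \<in> \<int>" using N(2) that by (blast intro: Ints_mult Ints_of_int)
      then show ?thesis by (simp add: mult_ac)
    qed
    moreover have "of_int (N * q) * x = of_int (N * p)" using q by simp
    then have "of_int (N * q) * x \<in> \<int>" by (metis Ints_of_int)
    ultimately show ?case
      using N(1) q(1) by (intro exI[of _ "N * q"] conjI ballI) auto
  qed
  then show thesis using that by blast
qed

lemma periodic_of_int:
  fixes f :: "real \<Rightarrow> 'a"
  assumes "\<And>z. f (z + \<tau>) = f z"
  shows "f (z + of_int n * \<tau>) = f z"
proof (induction n rule: int_induct[of _ 0])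
  case (step1 i)
  then show ?case using assms[of "z + of_int i * \<tau>"] by (simp add: algebra_simps)
next
  case (step2 i)
  then show ?case using assms[of "z + of_int (i - 1) * \<tau>"] by (simp add: algebra_simps)
qed simp

lemma antiderivative_of_periodic:
  fixes f g :: "real \<Rightarrow> real"
  assumes f: "\<And>z. (f has_real_derivative g z) (at z)" and g: "\<And>z. g (z + \<tau>) = g z" and \<tau>: "\<tau> > 0"
  shows "f (z + of_int n * \<tau>) = f z + of_int n * integral {0..\<tau>} g"
proof -
  have I: "integral {0..\<tau>} g = f \<tau> - f 0"
    by (intro integral_unique fundamental_theorem_of_calculus)
      (use \<tau> f in \<open>auto simp: has_real_derivative_iff_has_vector_derivative[symmetric] has_field_derivative_at_within\<close>)
  have shift: "f (z + \<tau>) - f z = f \<tau> - f 0" for z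
  proof -
    have "((\<lambda>z. f (z + \<tau>) - f z) has_real_derivative 0) (at z)" for z
      using DERIV_diff[OF _ f, of "\<lambda>z. f (z + \<tau>)" "g (z + \<tau>)" z] f[of "z + \<tau>"] by (simp add: g DERIV_shift)
    then have "f (z + \<tau>) - f z = f (0 + \<tau>) - f 0"
      using DERIV_isconst_all[of "\<lambda>z. f (z + \<tau>) - f z"] by blast
    then show ?thesis by simp
  qed
  \<comment> \<open>Subtracting the linear function whose slope is the mean of \<open>g\<close>
    leaves a periodic function, which takes care of all integer multiples, negative ones
    included.\<close>
  have "(\<lambda>z. f z - z / \<tau> * integral {0..\<tau>} g) (z + of_int n * \<tau>) = f z - z / \<tau> * integral {0..\<tau>} g"
  proof (rule periodic_of_int)
    show "f (z + \<tau>) - (z + \<tau>) / \<tau> * integral {0..\<tau>} g = f z - z / \<tau> * integral {0..\<tau>} g" for z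
      using shift[of z] \<tau> unfolding I by (simp add: add_divide_distrib distrib_right)
  qed
  then show ?thesis using \<tau> by (simp add: add_divide_distrib distrib_right)
qed

subsection \<open>The profile equation\<close>

lemma smooth_on_cis: "smooth_on UNIV cis"
  by (rule smooth_on_if_linear_ode[OF _ smooth_on_const[of _ \<i>]])
    (auto simp: has_vector_derivative_def intro!: derivative_eq_intros)

lemma smooth_on_real_derivative:
  assumes "smooth_on UNIV f"
  shows "(f has_real_derivative deriv f x) (at x)" "smooth_on UNIV (deriv f)"
proof -
  have D: "(f has_real_derivative dirderiv f 1 x) (at x)" for x
    using has_vector_derivative_line[of f 0 x 1 UNIV] smooth_on_differentiable[OF assms UNIV_I, of x]
    by (simp add: has_real_derivative_iff_has_vector_derivative)
  then have "deriv f = dirderiv f 1" by (auto intro: DERIV_imp_deriv)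
  then show "(f has_real_derivative deriv f x) (at x)" "smooth_on UNIV (deriv f)"
    using D smooth_on_dirderiv[OF assms] by simp_all
qed

lemma smooth_on_exp_mult:
  fixes u :: "real \<Rightarrow> real"
  assumes "smooth_on UNIV u"
  shows "smooth_on UNIV (\<lambda>z. exp (r * u z))"
proof (rule smooth_on_if_linear_ode)
  show "((\<lambda>z. exp (r * u z)) has_vector_derivative r * deriv u z * exp (r * u z)) (at z)" for z
    unfolding has_real_derivative_iff_has_vector_derivative[symmetric]
    by (auto intro!: derivative_eq_intros smooth_on_real_derivative[OF assms])
  show "smooth_on UNIV (\<lambda>z. r * deriv u z)"
    by (intro smooth_on_mult smooth_on_const smooth_on_real_derivative[OF assms] open_UNIV)
qed

context
  fixes u :: "real \<Rightarrow> real" and c C :: real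
  assumes u: "smooth_on UNIV u"
    and ode: "\<And>z. (deriv u z)\<^sup>2 + exp (2 * u z) + c\<^sup>2 * exp (- 6 * u z) - C = 0"
    and ne: "\<And>z. exp (2 * u z) \<noteq> C"
begin

text \<open>Differentiating the first order equation yields the second order one times
  \<open>deriv u z\<close>. This factor cannot be cancelled, because constant solutions are
  allowed.\<close>

lemma ode_derivative: "deriv u z * (deriv (deriv u) z + exp (2 * u z) - 3 * c\<^sup>2 * exp (- 6 * u z)) = 0"
proof -
  note D = smooth_on_real_derivative(1)[OF u] smooth_on_real_derivative(1)[OF smooth_on_real_derivative(2)[OF u]]
  have "((\<lambda>z. (deriv u z)\<^sup>2 + exp (2 * u z) + c\<^sup>2 * exp (- 6 * u z) - C) has_real_derivative
      2 * deriv u z * (deriv (deriv u) z + exp (2 * u z) - 3 * c\<^sup>2 * exp (- 6 * u z))) (at z)"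
    by (rule derivative_eq_intros D refl)+ (simp add: algebra_simps)
  moreover have "((\<lambda>z. (deriv u z)\<^sup>2 + exp (2 * u z) + c\<^sup>2 * exp (- 6 * u z) - C) has_real_derivative 0) (at z)"
    unfolding ode by simp
  ultimately show ?thesis using DERIV_unique by fastforce
qed

text \<open>Either \<open>u\<close> is constant or \<open>u'' + exp (2 u) = 3 c\<^sup>2 exp (- 6 u)\<close>, in which case \<open>\<kappa>\<close> vanishes. A proof
  by cases near each point shows only \<open>\<kappa> \<kappa>' = 0\<close>, which is enough.\<close>

lemma ode_invariant:
  defines "\<kappa> \<equiv> \<lambda>z. c * exp (- 2 * u z) * (3 * c\<^sup>2 * exp (- 6 * u z) - exp (2 * u z) - deriv (deriv u) z) *
    inverse (C - exp (2 * u z))"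
  shows "\<kappa> z = \<kappa> 0"
proof -
  define w where "w z = 3 * c\<^sup>2 * exp (- 6 * u z) - exp (2 * u z) - deriv (deriv u) z" for z
  have \<kappa>: "\<kappa> z = c * exp (- 2 * u z) * w z * inverse (C - exp (2 * u z))" for z
    by (simp add: \<kappa>_def w_def)
  note u' = smooth_on_real_derivative(2)[OF u]
  note u'' = smooth_on_real_derivative(2)[OF u']
  have sw: "smooth_on UNIV w"
    unfolding w_def by (intro smooth_on_diff smooth_on_mult smooth_on_const smooth_on_exp_mult u u'' open_UNIV)
  have "C - exp (2 * u z) \<noteq> 0" for z using ne[of z] by simp
  then have "smooth_on UNIV \<kappa>"
    unfolding \<kappa>[abs_def]
    by (intro smooth_on_diff smooth_on_mult smooth_on_const smooth_on_exp_mult smooth_on_inverse u sw open_UNIV)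
  note d\<kappa> = smooth_on_real_derivative(1)[OF this]
  \<comment> \<open>Where \<open>w\<close> vanishes, so does \<open>\<kappa>\<close>. Where it does
    not, it has no zero nearby either, so the derivative of \<open>u\<close> vanishes nearby and
    \<open>u\<close> and \<open>\<kappa>\<close> are locally constant.\<close>
  have \<kappa>\<kappa>': "2 * (\<kappa> z * deriv \<kappa> z) = 0" for z
  proof (cases "w z = 0")
    case True
    then show ?thesis by (simp add: \<kappa>)
  next
    case False
    have "open (UNIV \<inter> w -` (- {0}))"
      by (rule continuous_open_preimage[OF smooth_on_continuous[OF sw]]) auto
    moreover have "z \<in> UNIV \<inter> w -` (- {0})" using False by simp
    ultimately obtain d where d: "d > 0" "ball z d \<subseteq> UNIV \<inter> w -` (- {0})" by (rule openE)
    have u0: "deriv u y = 0" if "y \<in> ball z d" for y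
    proof -
      have "w y \<noteq> 0" using d(2) that by auto
      then show ?thesis using ode_derivative[of y] by (auto simp: w_def)
    qed
    have u1: "deriv (deriv u) y = 0" if "y \<in> ball z d" for y
    proof (rule DERIV_unique[OF smooth_on_real_derivative(1)[OF u']])
      show "(deriv u has_real_derivative 0) (at y)"
        by (rule has_field_derivative_transform_within_open[OF DERIV_const open_ball that]) (simp add: u0)
    qed
    have "\<exists>k. \<forall>y\<in>ball z d. u y = k"
      by (rule has_field_derivative_zero_constant[OF convex_ball])
        (metis smooth_on_real_derivative(1)[OF u] u0 has_field_derivative_at_within)
    then have uz: "u y = u z" if "y \<in> ball z d" for y
      using that d(1) by (metis centre_in_ball)
    have \<kappa>z: "\<kappa> z = \<kappa> y" if "y \<in> ball z d" for y
      using uz[OF that] u1[OF that] u1[of z] d(1) by (simp add: \<kappa>_def)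
    have "(\<kappa> has_real_derivative 0) (at z)"
      by (rule has_field_derivative_transform_within_open[OF DERIV_const open_ball centre_in_ball[THEN iffD2, OF d(1)] \<kappa>z])
    then show ?thesis using DERIV_unique[OF d\<kappa>] by simp
  qed
  \<comment> \<open>The square of \<open>\<kappa>\<close> is constant. If this constant is not 0,
    then \<open>\<kappa>\<close> has no zeros and can be cancelled from
    \<open>\<kappa>\<kappa>'\<close>.\<close>
  have "((\<lambda>z. \<kappa> z * \<kappa> z) has_real_derivative 0) (at z)" for z
    using DERIV_mult[OF d\<kappa> d\<kappa>, of z] \<kappa>\<kappa>'[of z] by (simp add: mult.commute)
  then have sq: "\<kappa> z * \<kappa> z = \<kappa> 0 * \<kappa> 0" for z
    using DERIV_isconst_all[of "\<lambda>z. \<kappa> z * \<kappa> z"] by blast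
  show ?thesis
  proof (cases "\<kappa> 0 = 0")
    case True
    then show ?thesis using sq[of z] by simp
  next
    case False
    then have "\<kappa> z \<noteq> 0" for z using sq[of z] by auto
    then have "(\<kappa> has_real_derivative 0) (at z)" for z
      using \<kappa>\<kappa>'[of z] d\<kappa>[of z] by simp
    then show ?thesis using DERIV_isconst_all[of \<kappa>] by blast
  qed
qed

end

text \<open>Differentiating a component multiplies it by its logarithmic derivative
  \<open>w\<close>. The profiles enter through \<open>S\<close>, which is explicit even where a
  phase is given only as an antiderivative.\<close>

lemma exponential_components:
  fixes \<psi> :: "real ^ 3 \<Rightarrow> complex ^ 4" and \<gamma> \<alpha> \<beta> :: "4 \<Rightarrow> real" and R S S' :: "4 \<Rightarrow> real \<Rightarrow> complex"
  assumes \<psi>: "\<And>p k. \<psi> p $ k = of_real (\<gamma> k) * R k (p $ 3) * cis (\<alpha> k * p $ 1 + \<beta> k * p $ 2)"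
    and R: "\<And>k z. (R k has_vector_derivative S k z * R k z) (at z)"
    and S: "\<And>k. smooth_on UNIV (S k)" "\<And>k z. (S k has_vector_derivative S' k z) (at z)"
  defines "w \<equiv> \<lambda>k v p. \<i> * of_real (\<alpha> k * v $ 1 + \<beta> k * v $ 2) + S k (p $ 3) * of_real (v $ 3)"
  shows "smooth_on UNIV \<psi>"
    and "dirderiv \<psi> v p $ k = w k v p * \<psi> p $ k"
    and "dirderiv (dirderiv \<psi> v) v p $ k = ((w k v p)\<^sup>2 + S' k (p $ 3) * (of_real (v $ 3))\<^sup>2) * \<psi> p $ k"
proof -
  define L where "L k p = \<alpha> k * p $ 1 + \<beta> k * p $ 2" for k and p :: "real ^ 3"
  have bl: "bounded_linear (L k)" for k
    unfolding L_def
    by (intro bounded_linear_add bounded_linear_const_mult bounded_linear_vec_nth)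
  have sR: "smooth_on UNIV (R k)" for k
    by (rule smooth_on_if_linear_ode[OF R S(1)])
  have sRp: "smooth_on UNIV (\<lambda>p. R k (p $ 3))" for k
    by (rule smooth_on_compose_linear[OF bounded_linear_vec_nth open_UNIV subset_UNIV sR])
  have scp: "smooth_on UNIV (\<lambda>p. cis (L k p))" for k
    by (rule smooth_on_compose_linear[OF bl open_UNIV subset_UNIV smooth_on_cis])
  show smooth: "smooth_on UNIV \<psi>"
    by (rule smooth_on_vec_componentwise[OF open_UNIV])
      (unfold \<psi> L_def[symmetric], intro smooth_on_mult open_UNIV smooth_on_const sRp scp)
  have vd: "((\<lambda>p. f (p $ 3)) has_derivative (\<lambda>v. v $ 3 *\<^sub>R f')) (at p)"
    if "(f has_vector_derivative f') (at (p $ 3))" for f :: "real \<Rightarrow> complex" and f' and p :: "real ^ 3"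
    using has_derivative_compose[OF bounded_linear_imp_has_derivative[OF bounded_linear_vec_nth]
        that[unfolded has_vector_derivative_def]] .
  have cd: "((\<lambda>p. cis (L k p)) has_derivative (\<lambda>v. L k v *\<^sub>R (\<i> * cis (L k p)))) (at p)" for k p
    by (rule has_derivative_cis[OF bounded_linear_imp_has_derivative[OF bl]])
  have comp: "((\<lambda>p. \<psi> p $ k) has_derivative (\<lambda>v. w k v p * \<psi> p $ k)) (at p)" for k p
  proof -
    have "((\<lambda>p. of_real (\<gamma> k) * (R k (p $ 3) * cis (L k p))) has_derivative
        (\<lambda>v. of_real (\<gamma> k) * (R k (p $ 3) * (L k v *\<^sub>R (\<i> * cis (L k p))) +
          v $ 3 *\<^sub>R (S k (p $ 3) * R k (p $ 3)) * cis (L k p)))) (at p)"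
      by (rule has_derivative_mult_right[OF has_derivative_mult[OF vd[OF R] cd]])
    then show ?thesis
      by (simp add: \<psi> L_def w_def scaleR_conv_of_real algebra_simps)
  qed
  have nth: "((\<lambda>p. f p $ k) has_derivative (\<lambda>v. dirderiv f v p $ k)) (at p)"
    if "smooth_on UNIV f" for f :: "real ^ 3 \<Rightarrow> complex ^ 4" and k p
    by (rule bounded_linear.has_derivative[OF bounded_linear_vec_nth smooth_on_has_derivative[OF that UNIV_I]])
  show d1: "dirderiv \<psi> v p $ k = w k v p * \<psi> p $ k" for v p k
    using fun_cong[OF has_derivative_unique[OF nth[OF smooth] comp]] .
  show "dirderiv (dirderiv \<psi> v) v p $ k = ((w k v p)\<^sup>2 + S' k (p $ 3) * (of_real (v $ 3))\<^sup>2) * \<psi> p $ k"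
  proof -
    have "((\<lambda>p. w k v p) has_derivative (\<lambda>u. 0 + u $ 3 *\<^sub>R S' k (p $ 3) * of_real (v $ 3))) (at p)"
      unfolding w_def
      by (rule has_derivative_add[OF has_derivative_const has_derivative_mult_left[OF vd[OF S(2)]]])
    from has_derivative_mult[OF this comp]
    have "((\<lambda>p. dirderiv \<psi> v p $ k) has_derivative
        (\<lambda>u. w k v p * (w k u p * \<psi> p $ k) + (0 + u $ 3 *\<^sub>R S' k (p $ 3) * of_real (v $ 3)) * \<psi> p $ k)) (at p)"
      by (simp add: d1)
    from fun_cong[OF has_derivative_unique[OF nth[OF smooth_on_dirderiv[OF smooth]] this], of v]
    show ?thesis
      by (simp add: scaleR_conv_of_real algebra_simps power2_eq_square)
  qed
qed

lemma has_vector_derivative_cis: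
  assumes "(f has_real_derivative f') (at x)"
  shows "((\<lambda>x. cis (f x)) has_vector_derivative f' *\<^sub>R (\<i> * cis (f x))) (at x)"
  using has_derivative_cis[OF assms[unfolded has_field_derivative_def]]
  by (simp add: has_vector_derivative_def mult.commute)

text \<open>Expanding the products leaves only the six moments in the assumptions. Here
  \<open>j\<close> is the imaginary unit, \<open>x\<close> is the contribution of the z-direction to
  the first vector and \<open>y\<close> the conjugate of that to the second; as independent
  variables they make both claims polynomial identities.\<close>

lemma frame_sums:
  fixes g\<^sub>1 g\<^sub>2 g\<^sub>3 a\<^sub>1 a\<^sub>2 a\<^sub>3 b\<^sub>1 b\<^sub>2 b\<^sub>3 K j :: complex
  assumes "g\<^sub>1 + g\<^sub>2 + g\<^sub>3 = K" "g\<^sub>1 * a\<^sub>1 + g\<^sub>2 * a\<^sub>2 + g\<^sub>3 * a\<^sub>3 = 0" "g\<^sub>1 * b\<^sub>1 + g\<^sub>2 * b\<^sub>2 + g\<^sub>3 * b\<^sub>3 = 0"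
    "g\<^sub>1 * a\<^sub>1\<^sup>2 + g\<^sub>2 * a\<^sub>2\<^sup>2 + g\<^sub>3 * a\<^sub>3\<^sup>2 = 1" "g\<^sub>1 * b\<^sub>1\<^sup>2 + g\<^sub>2 * b\<^sub>2\<^sup>2 + g\<^sub>3 * b\<^sub>3\<^sup>2 = 1"
    "g\<^sub>1 * a\<^sub>1 * b\<^sub>1 + g\<^sub>2 * a\<^sub>2 * b\<^sub>2 + g\<^sub>3 * a\<^sub>3 * b\<^sub>3 = 0" and j: "j * j = -1"
  shows "g\<^sub>1 * (j * (a\<^sub>1 * v\<^sub>1 + b\<^sub>1 * v\<^sub>2) + x) + g\<^sub>2 * (j * (a\<^sub>2 * v\<^sub>1 + b\<^sub>2 * v\<^sub>2) + x) +
      g\<^sub>3 * (j * (a\<^sub>3 * v\<^sub>1 + b\<^sub>3 * v\<^sub>2) + x) = K * x"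
    and "g\<^sub>1 * (j * (a\<^sub>1 * v\<^sub>1 + b\<^sub>1 * v\<^sub>2) + x) * (y - j * (a\<^sub>1 * w\<^sub>1 + b\<^sub>1 * w\<^sub>2)) +
      g\<^sub>2 * (j * (a\<^sub>2 * v\<^sub>1 + b\<^sub>2 * v\<^sub>2) + x) * (y - j * (a\<^sub>2 * w\<^sub>1 + b\<^sub>2 * w\<^sub>2)) +
      g\<^sub>3 * (j * (a\<^sub>3 * v\<^sub>1 + b\<^sub>3 * v\<^sub>2) + x) * (y - j * (a\<^sub>3 * w\<^sub>1 + b\<^sub>3 * w\<^sub>2)) =
      v\<^sub>1 * w\<^sub>1 + v\<^sub>2 * w\<^sub>2 + K * x * y"
proof -
  have "g\<^sub>1 * (j * (a\<^sub>1 * v\<^sub>1 + b\<^sub>1 * v\<^sub>2) + x) + g\<^sub>2 * (j * (a\<^sub>2 * v\<^sub>1 + b\<^sub>2 * v\<^sub>2) + x) +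
      g\<^sub>3 * (j * (a\<^sub>3 * v\<^sub>1 + b\<^sub>3 * v\<^sub>2) + x) =
      j * v\<^sub>1 * (g\<^sub>1 * a\<^sub>1 + g\<^sub>2 * a\<^sub>2 + g\<^sub>3 * a\<^sub>3) + j * v\<^sub>2 * (g\<^sub>1 * b\<^sub>1 + g\<^sub>2 * b\<^sub>2 + g\<^sub>3 * b\<^sub>3) + (g\<^sub>1 + g\<^sub>2 + g\<^sub>3) * x"
    by algebra
  then show "g\<^sub>1 * (j * (a\<^sub>1 * v\<^sub>1 + b\<^sub>1 * v\<^sub>2) + x) + g\<^sub>2 * (j * (a\<^sub>2 * v\<^sub>1 + b\<^sub>2 * v\<^sub>2) + x) +
      g\<^sub>3 * (j * (a\<^sub>3 * v\<^sub>1 + b\<^sub>3 * v\<^sub>2) + x) = K * x"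
    unfolding assms by simp
  have "g\<^sub>1 * (j * (a\<^sub>1 * v\<^sub>1 + b\<^sub>1 * v\<^sub>2) + x) * (y - j * (a\<^sub>1 * w\<^sub>1 + b\<^sub>1 * w\<^sub>2)) +
      g\<^sub>2 * (j * (a\<^sub>2 * v\<^sub>1 + b\<^sub>2 * v\<^sub>2) + x) * (y - j * (a\<^sub>2 * w\<^sub>1 + b\<^sub>2 * w\<^sub>2)) +
      g\<^sub>3 * (j * (a\<^sub>3 * v\<^sub>1 + b\<^sub>3 * v\<^sub>2) + x) * (y - j * (a\<^sub>3 * w\<^sub>1 + b\<^sub>3 * w\<^sub>2)) =
      - (j * j) * ((g\<^sub>1 * a\<^sub>1\<^sup>2 + g\<^sub>2 * a\<^sub>2\<^sup>2 + g\<^sub>3 * a\<^sub>3\<^sup>2) * (v\<^sub>1 * w\<^sub>1) + (g\<^sub>1 * b\<^sub>1\<^sup>2 + g\<^sub>2 * b\<^sub>2\<^sup>2 + g\<^sub>3 * b\<^sub>3\<^sup>2) * (v\<^sub>2 * w\<^sub>2)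
        + (g\<^sub>1 * a\<^sub>1 * b\<^sub>1 + g\<^sub>2 * a\<^sub>2 * b\<^sub>2 + g\<^sub>3 * a\<^sub>3 * b\<^sub>3) * (v\<^sub>1 * w\<^sub>2 + v\<^sub>2 * w\<^sub>1))
      + (g\<^sub>1 * a\<^sub>1 + g\<^sub>2 * a\<^sub>2 + g\<^sub>3 * a\<^sub>3) * (j * v\<^sub>1 * y - j * w\<^sub>1 * x)
      + (g\<^sub>1 * b\<^sub>1 + g\<^sub>2 * b\<^sub>2 + g\<^sub>3 * b\<^sub>3) * (j * v\<^sub>2 * y - j * w\<^sub>2 * x) + (g\<^sub>1 + g\<^sub>2 + g\<^sub>3) * (x * y)"
    by algebra
  then show "g\<^sub>1 * (j * (a\<^sub>1 * v\<^sub>1 + b\<^sub>1 * v\<^sub>2) + x) * (y - j * (a\<^sub>1 * w\<^sub>1 + b\<^sub>1 * w\<^sub>2)) +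
      g\<^sub>2 * (j * (a\<^sub>2 * v\<^sub>1 + b\<^sub>2 * v\<^sub>2) + x) * (y - j * (a\<^sub>2 * w\<^sub>1 + b\<^sub>2 * w\<^sub>2)) +
      g\<^sub>3 * (j * (a\<^sub>3 * v\<^sub>1 + b\<^sub>3 * v\<^sub>2) + x) * (y - j * (a\<^sub>3 * w\<^sub>1 + b\<^sub>3 * w\<^sub>2)) =
      v\<^sub>1 * w\<^sub>1 + v\<^sub>2 * w\<^sub>2 + K * x * y"
    unfolding assms by simp
qed

text \<open>\<open>X\<close> and \<open>Y\<close> are the logarithmic derivatives \<open>P' / P\<close> and \<open>Q' / Q\<close> at a point, with \<open>v = u'\<close>,
  \<open>s = u''\<close>, \<open>t = c\<^sub>3 exp (- 3 u)\<close> and \<open>e = exp (2 u)\<close>.\<close>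

lemma profile_laplacian:
  fixes v t s e D C n :: real
  assumes D: "D = v\<^sup>2 + t\<^sup>2" "D \<noteq> 0" and e: "e = C - D" and vs: "v * (s + e - 3 * t\<^sup>2) = 0"
    and n: "n = t * (3 * t\<^sup>2 - e - s) / D"
  defines "X \<equiv> Complex v t" and "X' \<equiv> Complex s (- 3 * v * t)"
  defines "Y \<equiv> - (of_real (e / D) * X)"
  defines "Y' \<equiv> - (of_real (2 * v * e * C / D\<^sup>2) * X + of_real (e / D) * X')"
  shows "X\<^sup>2 + X' - 2 * of_real C = - 3 * of_real e + Complex (- v) n * X"
    and "Y\<^sup>2 + Y' = - 3 * of_real e + Complex (- v) n * Y"
proof -
  have nD: "n * D = t * (3 * t\<^sup>2 - e - s)" using n D by simp
  \<comment> \<open>By \<open>vs\<close> the numerator of \<open>n\<close> vanishes unless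
    \<open>v\<close> does, so \<open>n * v\<close> is 0 in either case.\<close>
  have "D * (n * v) = 0" using nD vs by algebra
  then have nv: "n * v = 0" using D(2) by simp
  have "D * (v\<^sup>2 - t\<^sup>2 + s - 2 * C + 3 * e + v\<^sup>2 + n * t) = 0" using nD vs D(1) e by algebra
  then have nt: "v\<^sup>2 - t\<^sup>2 + s - 2 * C + 3 * e + v\<^sup>2 + n * t = 0" using D(2) by simp
  show X: "X\<^sup>2 + X' - 2 * of_real C = - 3 * of_real e + Complex (- v) n * X"
    using nv nt by (simp add: X_def X'_def complex_eq_iff power2_eq_square algebra_simps)
  \<comment> \<open>The real quadratic with roots \<open>X\<close> and its conjugate eliminates
    \<open>X\<^sup>2\<close>. With \<open>r\<close> for the inverse of \<open>D\<close>, the second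
    identity becomes a polynomial consequence of the first.\<close>
  have q: "X\<^sup>2 - 2 * of_real v * X + of_real D = 0"
    by (simp add: X_def D(1) complex_eq_iff power2_eq_square)
  define r where "r = (1 / of_real D :: complex)"
  have r: "r * of_real D = 1" using D(2) by (simp add: r_def)
  have Y: "Y = - (of_real e * r * X)" "Y' = - (2 * of_real v * of_real e * of_real C * r\<^sup>2 * X + of_real e * r * X')"
    by (simp_all add: Y_def Y'_def r_def power_one_over)
  have ec: "of_real e = of_real C - (of_real D :: complex)" by (simp add: e)
  show "Y\<^sup>2 + Y' = - 3 * of_real e + Complex (- v) n * Y"
    unfolding Y using X q r ec by algebra
qed

subsection \<open>The tori\<close>

theorem theorem3p4:
  fixes a b c\<^sub>1 c\<^sub>2 c\<^sub>3 C B \<tau> :: real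
    and \<alpha>\<^sub>1 \<alpha>\<^sub>2 \<alpha>\<^sub>3 \<beta>\<^sub>1 \<beta>\<^sub>2 \<beta>\<^sub>3 \<gamma>\<^sub>1 \<gamma>\<^sub>2 \<gamma>\<^sub>3 \<gamma>\<^sub>4 :: real
    and u \<theta> \<eta> :: "real \<Rightarrow> real"
    and P Q :: "real \<Rightarrow> complex"
    and \<psi> :: "real ^ 3 \<Rightarrow> complex ^ 4"
  assumes C: "C = a * c\<^sub>1 + b * c\<^sub>2 + 2 * c\<^sub>1\<^sup>2 + 2 * c\<^sub>2\<^sup>2"
    and B: "B = 2 * c\<^sub>1 * a + 3 * c\<^sub>1\<^sup>2 + c\<^sub>2 * b + 3 * c\<^sub>2\<^sup>2"
    and u_smooth: "smooth_on UNIV u"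
    and u_ode: "\<And>z. (deriv u z)\<^sup>2 + exp (2 * u z) + c\<^sub>3\<^sup>2 * exp (- 6 * u z) - C = 0"
    and u_periodic: "\<tau> > 0" "\<And>z. u (z + \<tau>) = u z"
    and c1_rat: "c\<^sub>1 \<in> \<rat>"
    and period_rat: "c\<^sub>3 * C / (2 * pi) *
           integral {0..\<tau>} (\<lambda>z. exp (- 3 * u z) / (exp (2 * u z) - C)) \<in> \<rat>"
    and roots_rat: "\<alpha>\<^sub>1 \<in> \<rat>" "\<alpha>\<^sub>2 \<in> \<rat>" "\<alpha>\<^sub>3 \<in> \<rat>"
    and roots_distinct: "\<alpha>\<^sub>1 \<noteq> \<alpha>\<^sub>2" "\<alpha>\<^sub>1 \<noteq> \<alpha>\<^sub>3" "\<alpha>\<^sub>2 \<noteq> \<alpha>\<^sub>3"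
    and roots: "\<alpha>\<^sub>1 ^ 3 + a * \<alpha>\<^sub>1\<^sup>2 - B * \<alpha>\<^sub>1 + c\<^sub>1 * C = 0"
               "\<alpha>\<^sub>2 ^ 3 + a * \<alpha>\<^sub>2\<^sup>2 - B * \<alpha>\<^sub>2 + c\<^sub>1 * C = 0"
               "\<alpha>\<^sub>3 ^ 3 + a * \<alpha>\<^sub>3\<^sup>2 - B * \<alpha>\<^sub>3 + c\<^sub>1 * C = 0"
    and nonzero_denominators: "\<And>z. exp (2 * u z) \<noteq> C"
               "\<alpha>\<^sub>1 \<noteq> c\<^sub>1" "\<alpha>\<^sub>2 \<noteq> c\<^sub>1" "\<alpha>\<^sub>3 \<noteq> c\<^sub>1"
    and \<beta>: "\<beta>\<^sub>1 = c\<^sub>2 * \<alpha>\<^sub>1 / (\<alpha>\<^sub>1 - c\<^sub>1)"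
           "\<beta>\<^sub>2 = c\<^sub>2 * \<alpha>\<^sub>2 / (\<alpha>\<^sub>2 - c\<^sub>1)"
           "\<beta>\<^sub>3 = c\<^sub>2 * \<alpha>\<^sub>3 / (\<alpha>\<^sub>3 - c\<^sub>1)"
    and \<theta>: "\<And>z. (\<theta> has_real_derivative exp (- 3 * u z)) (at z)"
    and \<eta>: "\<And>z. (\<eta> has_real_derivative exp (- u z) / (exp (2 * u z) - C)) (at z)"
    and P: "\<And>z. P z = exp (of_real (u z) + \<i> * of_real (c\<^sub>3 * \<theta> z))"
    and Q: "\<And>z. Q z = of_real (sqrt (C - exp (2 * u z))) * exp (\<i> * of_real (c\<^sub>3 * \<eta> z))"
    and \<gamma>: "\<gamma>\<^sub>1 = sqrt ((C + \<alpha>\<^sub>2 * \<alpha>\<^sub>3) / (C * (\<alpha>\<^sub>1 - \<alpha>\<^sub>2) * (\<alpha>\<^sub>1 - \<alpha>\<^sub>3)))"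
           "\<gamma>\<^sub>2 = sqrt ((C + \<alpha>\<^sub>1 * \<alpha>\<^sub>3) / (C * (\<alpha>\<^sub>2 - \<alpha>\<^sub>1) * (\<alpha>\<^sub>2 - \<alpha>\<^sub>3)))"
           "\<gamma>\<^sub>3 = sqrt ((C + \<alpha>\<^sub>1 * \<alpha>\<^sub>2) / (C * (\<alpha>\<^sub>3 - \<alpha>\<^sub>1) * (\<alpha>\<^sub>3 - \<alpha>\<^sub>2)))"
           "\<gamma>\<^sub>4 = sqrt (1 / C)"
    and \<psi>: "\<And>x y z. \<psi> (vector [x, y, z]) = vector
           [of_real \<gamma>\<^sub>1 * P z * exp (\<i> * of_real (x * \<alpha>\<^sub>1 + y * \<beta>\<^sub>1)),
            of_real \<gamma>\<^sub>2 * P z * exp (\<i> * of_real (x * \<alpha>\<^sub>2 + y * \<beta>\<^sub>2)),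
            of_real \<gamma>\<^sub>3 * P z * exp (\<i> * of_real (x * \<alpha>\<^sub>3 + y * \<beta>\<^sub>3)),
            of_real \<gamma>\<^sub>4 * Q z]"
  shows "(\<forall>p. \<psi> p \<in> sphere 0 1) \<and>
         (\<exists>A. immersed_torus A \<psi> \<and> lagrangian \<psi> \<and> conformally_flat \<psi> \<and> hamiltonian_minimal A \<psi>)"
proof -

  \<comment> \<open>The profile functions and their signs\<close>
  define e where "e z = exp (2 * u z)" for z
  define D where "D z = C - e z" for z
  define t where "t z = c\<^sub>3 * exp (- 3 * u z)" for z
  define v where "v z = deriv u z" for z
  define s where "s z = deriv (deriv u) z" for z
  define X where "X z = Complex (v z) (t z)" for z
  define X' where "X' z = Complex (s z) (- 3 * v z * t z)" for z
  \<comment> \<open>Horizontality in the z-direction forces this multiple of \<open>X z\<close>: the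
    squared moduli of the first three components add up to \<open>e z / C\<close>, and that of the
    last is \<open>D z / C\<close>.\<close>
  define Y where "Y z = - (of_real (e z / D z) * X z)" for z
  define Y' where "Y' z = - (of_real (2 * v z * e z * C / (D z)\<^sup>2) * X z + of_real (e z / D z) * X' z)" for z
  have t2: "(t z)\<^sup>2 = c\<^sub>3\<^sup>2 * exp (- 6 * u z)" for z
    by (simp add: t_def power_mult_distrib flip: exp_double)
  have Dv: "D z = (v z)\<^sup>2 + (t z)\<^sup>2" for z
    using u_ode[of z] by (simp add: D_def e_def v_def t2)
  have D0: "D z \<noteq> 0" for z
    using nonzero_denominators(1)[of z] by (simp add: D_def e_def)
  \<comment> \<open>By the profile equation \<open>D\<close> is a sum of two squares, so a nonzero
    denominator is a positive one. Hence the root in \<open>Q\<close> is real, and \<open>C\<close>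
    is positive.\<close>
  have Dpos: "D z > 0" for z
    using D0[of z] by (simp add: Dv less_le)
  have epos: "e z > 0" for z by (simp add: e_def)
  have C0: "C > 0"
    using Dpos[of 0] epos[of 0] by (simp add: D_def)
  have e_eq: "e z = C - D z" for z by (simp add: D_def)
  have vs: "v z * (s z + e z - 3 * (t z)\<^sup>2) = 0" for z
    using ode_derivative[OF u_smooth u_ode nonzero_denominators(1)] by (simp add: v_def s_def e_def t2 mult.assoc)

  \<comment> \<open>The roots and their weights\<close>
  note root_data = C C0 B
  have orth: "C + \<alpha>\<^sub>1 * \<alpha>\<^sub>2 + \<beta>\<^sub>1 * \<beta>\<^sub>2 = 0" "C + \<alpha>\<^sub>1 * \<alpha>\<^sub>3 + \<beta>\<^sub>1 * \<beta>\<^sub>3 = 0" "C + \<alpha>\<^sub>2 * \<alpha>\<^sub>3 + \<beta>\<^sub>2 * \<beta>\<^sub>3 = 0"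
    using root_orthogonal[OF root_data roots(1,2,3) _ _ _ _ _ _ \<beta>(1,2)]
      root_orthogonal[OF root_data roots(1,3,2) _ _ _ _ _ _ \<beta>(1,3)]
      root_orthogonal[OF root_data roots(2,3,1) _ _ _ _ _ _ \<beta>(2,3)]
      roots_distinct nonzero_denominators(2-4) by auto
  note sums = weighted_orthogonality[OF C0 orth roots_distinct \<gamma>(1-3)]
  have norms: "\<alpha>\<^sub>1\<^sup>2 + \<beta>\<^sub>1\<^sup>2 = 2 * C - a * \<alpha>\<^sub>1 - b * \<beta>\<^sub>1" "\<alpha>\<^sub>2\<^sup>2 + \<beta>\<^sub>2\<^sup>2 = 2 * C - a * \<alpha>\<^sub>2 - b * \<beta>\<^sub>2"
    "\<alpha>\<^sub>3\<^sup>2 + \<beta>\<^sub>3\<^sup>2 = 2 * C - a * \<alpha>\<^sub>3 - b * \<beta>\<^sub>3"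
    by (rule root_norm[OF C B roots(1) nonzero_denominators(2) \<beta>(1)]
        root_norm[OF C B roots(2) nonzero_denominators(3) \<beta>(2)]
        root_norm[OF C B roots(3) nonzero_denominators(4) \<beta>(3)])+
  \<comment> \<open>Needed for the second side of the period box, which is divided by the absolute
    value of \<open>c\<^sub>2\<close>.\<close>
  have c2: "c\<^sub>2 \<noteq> 0"
  proof
    assume "c\<^sub>2 = 0"
    then have "C + \<alpha>\<^sub>1 * \<alpha>\<^sub>2 = 0" "C + \<alpha>\<^sub>1 * \<alpha>\<^sub>3 = 0" using orth \<beta> by simp_all
    then have "\<alpha>\<^sub>1 * \<alpha>\<^sub>2 = \<alpha>\<^sub>1 * \<alpha>\<^sub>3" by linarith
    then show False using roots_distinct C0 \<open>C + \<alpha>\<^sub>1 * \<alpha>\<^sub>2 = 0\<close> by simp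
  qed

  \<comment> \<open>Derivatives and smoothness of the profile functions\<close>
  have du: "(u has_real_derivative v z) (at z)" for z
    unfolding v_def by (rule smooth_on_real_derivative[OF u_smooth])
  have sv: "smooth_on UNIV v"
    unfolding v_def[abs_def] by (rule smooth_on_real_derivative[OF u_smooth])
  have dv: "(v has_real_derivative s z) (at z)" for z
    using smooth_on_real_derivative(1)[OF sv] by (simp add: s_def v_def[abs_def])
  have dt: "(t has_real_derivative - 3 * v z * t z) (at z)" for z
    unfolding t_def by (auto intro!: derivative_eq_intros du)
  have de: "(e has_real_derivative 2 * v z * e z) (at z)" for z
    unfolding e_def by (auto intro!: derivative_eq_intros du)
  have dq: "((\<lambda>z. e z / D z) has_real_derivative 2 * v z * e z * C / (D z)\<^sup>2) (at z)" for z
  proof -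
    have "((\<lambda>z. e z / (C - e z)) has_real_derivative
        (2 * v z * e z * (C - e z) - e z * (0 - 2 * v z * e z)) / ((C - e z) * (C - e z))) (at z)"
      by (rule DERIV_divide[OF de DERIV_diff[OF DERIV_const de]]) (use D0[of z] in \<open>simp add: D_def\<close>)
    then show ?thesis by (simp add: D_def power2_eq_square algebra_simps)
  qed
  note of_real_vd = bounded_linear.has_vector_derivative[OF bounded_linear_of_real]
  have X_eq: "X z = of_real (v z) + \<i> * of_real (t z)" "X' z = of_real (s z) + \<i> * of_real (- 3 * v z * t z)" for z
    by (simp_all add: X_def X'_def complex_eq_iff)
  have dX: "(X has_vector_derivative X' z) (at z)" for z
    unfolding X_eq[abs_def]
    by (intro has_vector_derivative_add has_vector_derivative_mult_right of_real_vd)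
      (use dv dt in \<open>simp_all add: has_real_derivative_iff_has_vector_derivative\<close>)
  have dY: "(Y has_vector_derivative Y' z) (at z)" for z
  proof -
    have "((\<lambda>z. - (of_real (e z / D z) * X z)) has_vector_derivative
        - (of_real (e z / D z) * X' z + of_real (2 * v z * e z * C / (D z)\<^sup>2) * X z)) (at z)"
      by (intro has_vector_derivative_minus has_vector_derivative_mult dX of_real_vd)
        (use dq in \<open>simp add: has_real_derivative_iff_has_vector_derivative\<close>)
    then show ?thesis by (simp add: Y_def[abs_def] Y'_def add.commute)
  qed
  have se: "smooth_on UNIV e" and st: "smooth_on UNIV t"
    unfolding e_def t_def by (intro smooth_on_mult smooth_on_const smooth_on_exp_mult u_smooth open_UNIV)+
  have of_real_smooth: "smooth_on UNIV f \<Longrightarrow> smooth_on UNIV (\<lambda>z. complex_of_real (f z))" for f :: "real \<Rightarrow> real"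
    by (rule smooth_on_bounded_linear[OF bounded_linear_of_real open_UNIV])
  have sX: "smooth_on UNIV X"
    unfolding X_eq[abs_def] by (intro smooth_on_add smooth_on_mult smooth_on_const of_real_smooth sv st open_UNIV)
  have sY: "smooth_on UNIV Y"
    unfolding Y_def[abs_def] divide_inverse
    by (rule smooth_on_minus[OF open_UNIV smooth_on_mult[OF open_UNIV of_real_smooth[OF smooth_on_mult[OF open_UNIV se
            smooth_on_inverse[OF open_UNIV]]] sX]])
      (use D0 in \<open>auto simp: D_def[abs_def] intro!: smooth_on_diff smooth_on_const se\<close>)
  have P_eq: "P z = of_real (exp (u z)) * cis (c\<^sub>3 * \<theta> z)" for z
    by (simp add: P exp_add exp_of_real cis_conv_exp)
  have Q_eq: "Q z = of_real (sqrt (D z)) * cis (c\<^sub>3 * \<eta> z)" for z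
    by (simp add: Q D_def e_def cis_conv_exp)
  have dP: "(P has_vector_derivative X z * P z) (at z)" for z
  proof -
    have "((\<lambda>z. of_real (exp (u z)) * cis (c\<^sub>3 * \<theta> z)) has_vector_derivative
        of_real (exp (u z)) * (t z *\<^sub>R (\<i> * cis (c\<^sub>3 * \<theta> z))) + of_real (v z * exp (u z)) * cis (c\<^sub>3 * \<theta> z)) (at z)"
    proof (intro has_vector_derivative_mult of_real_vd)
      show "((\<lambda>z. exp (u z)) has_vector_derivative v z * exp (u z)) (at z)"
        unfolding has_real_derivative_iff_has_vector_derivative[symmetric]
        by (auto intro!: derivative_eq_intros du)
      show "((\<lambda>z. cis (c\<^sub>3 * \<theta> z)) has_vector_derivative t z *\<^sub>R (\<i> * cis (c\<^sub>3 * \<theta> z))) (at z)"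
        using has_vector_derivative_cis[OF DERIV_cmult[OF \<theta>, of c\<^sub>3 z]] by (simp add: t_def)
    qed
    then show ?thesis by (simp add: P_eq[abs_def] X_eq scaleR_conv_of_real algebra_simps)
  qed
  have dQ: "(Q has_vector_derivative Y z * Q z) (at z)" for z
  proof -
    have \<eta>': "exp (- u z) / (exp (2 * u z) - C) = - (exp (- u z) / D z)"
      using D0[of z] by (simp add: D_def e_def field_simps)
    have q: "c\<^sub>3 * exp (- u z) = e z * t z"
      by (simp add: e_def t_def flip: exp_add)
    have sq: "sqrt (D z) * sqrt (D z) = D z" using Dpos[of z] by simp
    have "((\<lambda>z. of_real (sqrt (D z)) * cis (c\<^sub>3 * \<eta> z)) has_vector_derivative
        of_real (sqrt (D z)) * ((- (e z * t z) / D z) *\<^sub>R (\<i> * cis (c\<^sub>3 * \<eta> z))) +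
        of_real (- (e z * v z) / D z * sqrt (D z)) * cis (c\<^sub>3 * \<eta> z)) (at z)"
    proof (intro has_vector_derivative_mult of_real_vd)
      have dD: "(D has_real_derivative - (2 * v z * e z)) (at z)"
        unfolding D_def by (auto intro!: derivative_eq_intros de)
      have "((\<lambda>z. sqrt (D z)) has_real_derivative (inverse (sqrt (D z)) / 2) * (- (2 * v z * e z))) (at z)"
        by (rule DERIV_chain'[OF dD DERIV_real_sqrt[OF Dpos]])
      moreover have "(inverse (sqrt (D z)) / 2) * (- (2 * v z * e z)) = - (e z * v z) / D z * sqrt (D z)"
        using Dpos[of z] sq by (simp add: field_simps)
      ultimately show "((\<lambda>z. sqrt (D z)) has_vector_derivative - (e z * v z) / D z * sqrt (D z)) (at z)"
        by (simp add: has_real_derivative_iff_has_vector_derivative)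
      show "((\<lambda>z. cis (c\<^sub>3 * \<eta> z)) has_vector_derivative (- (e z * t z) / D z) *\<^sub>R (\<i> * cis (c\<^sub>3 * \<eta> z))) (at z)"
      proof -
        have "((\<lambda>z. c\<^sub>3 * \<eta> z) has_real_derivative - (e z * t z) / D z) (at z)"
          using DERIV_cmult[OF \<eta>, of c\<^sub>3 z] by (simp add: \<eta>' flip: q)
        then show ?thesis by (rule has_vector_derivative_cis)
      qed
    qed
    then show ?thesis by (simp add: Q_eq[abs_def] Y_def X_eq scaleR_conv_of_real algebra_simps add_divide_distrib)
  qed

  \<comment> \<open>The components of the lift, the last one with frequency 0\<close>
  define \<gamma>' \<alpha>' \<beta>' where "\<gamma>' k = (vector [\<gamma>\<^sub>1, \<gamma>\<^sub>2, \<gamma>\<^sub>3, \<gamma>\<^sub>4] :: real ^ 4) $ k"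
    and "\<alpha>' k = (vector [\<alpha>\<^sub>1, \<alpha>\<^sub>2, \<alpha>\<^sub>3, 0] :: real ^ 4) $ k"
    and "\<beta>' k = (vector [\<beta>\<^sub>1, \<beta>\<^sub>2, \<beta>\<^sub>3, 0] :: real ^ 4) $ k" for k
  define R S S' where "R k z = (vector [P z, P z, P z, Q z] :: complex ^ 4) $ k"
    and "S k z = (vector [X z, X z, X z, Y z] :: complex ^ 4) $ k"
    and "S' k z = (vector [X' z, X' z, X' z, Y' z] :: complex ^ 4) $ k" for k z
  note components = \<gamma>'_def \<alpha>'_def \<beta>'_def R_def S_def S'_def vector_4
  have pv: "vector [p $ 1, p $ 2, p $ 3] = p" for p :: "real ^ 3"
    by (simp add: vec_eq_iff forall_3)
  have \<psi>k: "\<psi> p $ k = of_real (\<gamma>' k) * R k (p $ 3) * cis (\<alpha>' k * p $ 1 + \<beta>' k * p $ 2)" for p k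
  proof -
    have "\<forall>k. \<psi> p $ k = of_real (\<gamma>' k) * R k (p $ 3) * cis (\<alpha>' k * p $ 1 + \<beta>' k * p $ 2)"
      unfolding forall_4 using \<psi>[of "p $ 1" "p $ 2" "p $ 3"]
      by (simp add: pv components cis_conv_exp mult.commute)
    then show ?thesis by blast
  qed
  have dR: "(R k has_vector_derivative S k z * R k z) (at z)" for k z
  proof -
    have "\<forall>k. (R k has_vector_derivative S k z * R k z) (at z)"
      unfolding forall_4 components[abs_def] using dP dQ by simp
    then show ?thesis by blast
  qed
  have dS: "(S k has_vector_derivative S' k z) (at z)" for k z
  proof -
    have "\<forall>k. (S k has_vector_derivative S' k z) (at z)"
      unfolding forall_4 components[abs_def] using dX dY by simp
    then show ?thesis by blast
  qed
  have sS: "smooth_on UNIV (S k)" for k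
  proof -
    have "\<forall>k. smooth_on UNIV (S k)"
      unfolding forall_4 components[abs_def] using sX sY by simp
    then show ?thesis by blast
  qed
  define w where "w k h p = \<i> * of_real (\<alpha>' k * h $ 1 + \<beta>' k * h $ 2) + S k (p $ 3) * of_real (h $ 3)"
    for k and h p :: "real ^ 3"
  note smooth = exponential_components(1)[OF \<psi>k dR sS dS]
  note d\<psi> = exponential_components(2)[OF \<psi>k dR sS dS, folded w_def]
  note dd\<psi> = exponential_components(3)[OF \<psi>k dR sS dS, folded w_def]
  \<comment> \<open>The squared moduli of the components, which depend on z alone. Every Hermitian
    product of derivatives of the lift becomes a sum with these weights.\<close>
  define \<nu> where "\<nu> k z = (vector [\<gamma>\<^sub>1\<^sup>2 * e z, \<gamma>\<^sub>2\<^sup>2 * e z, \<gamma>\<^sub>3\<^sup>2 * e z, D z / C] :: real ^ 4) $ k" for k z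
  have \<nu>: "\<psi> p $ k * cnj (\<psi> p $ k) = of_real (\<nu> k (p $ 3))" for p k
  proof -
    have "(cmod (P z))\<^sup>2 = e z" "(cmod (Q z))\<^sup>2 = D z" for z
      using Dpos[of z] by (simp_all add: P_eq Q_eq norm_mult e_def exp_double)
    then have "\<forall>k. (\<gamma>' k)\<^sup>2 * (cmod (R k z))\<^sup>2 = \<nu> k z" for z
      unfolding forall_4 using C0 by (simp add: components \<nu>_def \<gamma>(4))
    moreover have "\<psi> p $ k * cnj (\<psi> p $ k) = of_real ((\<gamma>' k)\<^sup>2 * (cmod (R k (p $ 3)))\<^sup>2)"
      unfolding complex_norm_square[symmetric] by (simp add: \<psi>k norm_mult power_mult_distrib)
    ultimately show ?thesis by simp
  qed
  have herm_\<psi>: "herm x y = (\<Sum>k\<in>UNIV. A k * cnj (B k) * of_real (\<nu> k (p $ 3)))"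
    if "\<And>k. x $ k = A k * \<psi> p $ k" "\<And>k. y $ k = B k * \<psi> p $ k" for x y A B p
  proof -
    have "x $ k * cnj (y $ k) = A k * cnj (B k) * (\<psi> p $ k * cnj (\<psi> p $ k))" for k
      by (simp add: that)
    then show ?thesis by (simp add: herm_def \<nu>)
  qed
  have csums: "complex_of_real (\<gamma>\<^sub>1\<^sup>2) + of_real (\<gamma>\<^sub>2\<^sup>2) + of_real (\<gamma>\<^sub>3\<^sup>2) = of_real (1 / C)"
    "complex_of_real (\<gamma>\<^sub>1\<^sup>2) * of_real \<alpha>\<^sub>1 + of_real (\<gamma>\<^sub>2\<^sup>2) * of_real \<alpha>\<^sub>2 + of_real (\<gamma>\<^sub>3\<^sup>2) * of_real \<alpha>\<^sub>3 = 0"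
    "complex_of_real (\<gamma>\<^sub>1\<^sup>2) * of_real \<beta>\<^sub>1 + of_real (\<gamma>\<^sub>2\<^sup>2) * of_real \<beta>\<^sub>2 + of_real (\<gamma>\<^sub>3\<^sup>2) * of_real \<beta>\<^sub>3 = 0"
    "complex_of_real (\<gamma>\<^sub>1\<^sup>2) * (of_real \<alpha>\<^sub>1)\<^sup>2 + of_real (\<gamma>\<^sub>2\<^sup>2) * (of_real \<alpha>\<^sub>2)\<^sup>2 + of_real (\<gamma>\<^sub>3\<^sup>2) * (of_real \<alpha>\<^sub>3)\<^sup>2 = 1"
    "complex_of_real (\<gamma>\<^sub>1\<^sup>2) * (of_real \<beta>\<^sub>1)\<^sup>2 + of_real (\<gamma>\<^sub>2\<^sup>2) * (of_real \<beta>\<^sub>2)\<^sup>2 + of_real (\<gamma>\<^sub>3\<^sup>2) * (of_real \<beta>\<^sub>3)\<^sup>2 = 1"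
    "complex_of_real (\<gamma>\<^sub>1\<^sup>2) * of_real \<alpha>\<^sub>1 * of_real \<beta>\<^sub>1 + of_real (\<gamma>\<^sub>2\<^sup>2) * of_real \<alpha>\<^sub>2 * of_real \<beta>\<^sub>2
      + of_real (\<gamma>\<^sub>3\<^sup>2) * of_real \<alpha>\<^sub>3 * of_real \<beta>\<^sub>3 = 0"
    by (simp_all only: of_real_add[symmetric] of_real_mult[symmetric] of_real_power[symmetric] sums of_real_0 of_real_1)
  note frame = frame_sums[OF csums i_squared]
  define E where "E p = exp (u (p $ 3))" for p :: "real ^ 3"
  have Epos: "E p > 0" for p by (simp add: E_def)
  have E2: "(E p)\<^sup>2 = e (p $ 3)" for p by (simp add: E_def e_def exp_double)

  \<comment> \<open>Unit length, horizontality and conformality\<close>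
  have sphere: "\<psi> p \<in> sphere 0 1" for p
  proof -
    have "herm (\<psi> p) (\<psi> p) = of_real (\<Sum>k\<in>UNIV. \<nu> k (p $ 3))"
      using herm_\<psi>[of "\<psi> p" "\<lambda>_. 1" p "\<psi> p" "\<lambda>_. 1"] by simp
    also have "(\<Sum>k\<in>UNIV. \<nu> k (p $ 3)) = (\<gamma>\<^sub>1\<^sup>2 + \<gamma>\<^sub>2\<^sup>2 + \<gamma>\<^sub>3\<^sup>2) * e (p $ 3) + D (p $ 3) / C"
      by (simp add: sum_4 \<nu>_def vector_4 algebra_simps)
    also have "\<dots> = 1"
      unfolding sums(1) using C0 by (simp add: e_eq diff_divide_distrib)
    finally have "(norm (\<psi> p))\<^sup>2 = 1" by (simp add: herm_self del: of_real_power)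
    then show ?thesis by (simp add: abs_square_eq_1)
  qed
  have hor: "herm (dirderiv \<psi> h p) (\<psi> p) = 0" for h p
  proof -
    let ?z = "p $ 3"
    let ?x = "X ?z * of_real (h $ 3)"
    have "herm (dirderiv \<psi> h p) (\<psi> p) = (\<Sum>k\<in>UNIV. w k h p * of_real (\<nu> k ?z))"
      using herm_\<psi>[of "dirderiv \<psi> h p" "\<lambda>k. w k h p" p "\<psi> p" "\<lambda>_. 1"] d\<psi> by simp
    also have "\<dots> = of_real (e ?z) *
        (of_real (\<gamma>\<^sub>1\<^sup>2) * (\<i> * (of_real \<alpha>\<^sub>1 * of_real (h $ 1) + of_real \<beta>\<^sub>1 * of_real (h $ 2)) + ?x) +
         of_real (\<gamma>\<^sub>2\<^sup>2) * (\<i> * (of_real \<alpha>\<^sub>2 * of_real (h $ 1) + of_real \<beta>\<^sub>2 * of_real (h $ 2)) + ?x) +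
         of_real (\<gamma>\<^sub>3\<^sup>2) * (\<i> * (of_real \<alpha>\<^sub>3 * of_real (h $ 1) + of_real \<beta>\<^sub>3 * of_real (h $ 2)) + ?x)) +
        Y ?z * of_real (h $ 3) * of_real (D ?z / C)"
      by (simp add: sum_4 w_def components \<nu>_def algebra_simps)
    also have "\<dots> = 0"
      unfolding frame(1) using D0[of ?z] C0 by (simp add: Y_def)
    finally show ?thesis .
  qed
  have conf: "herm (dirderiv \<psi> h p) (dirderiv \<psi> l p) = of_real ((E p)\<^sup>2 * (h \<bullet> l))" for h l p
  proof -
    let ?z = "p $ 3"
    let ?x = "X ?z * of_real (h $ 3)" and ?y = "cnj (X ?z) * of_real (l $ 3)"
    have "herm (dirderiv \<psi> h p) (dirderiv \<psi> l p) = (\<Sum>k\<in>UNIV. w k h p * cnj (w k l p) * of_real (\<nu> k ?z))"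
      by (rule herm_\<psi>) (rule d\<psi>)+
    also have "\<dots> = of_real (e ?z) *
        (of_real (\<gamma>\<^sub>1\<^sup>2) * (\<i> * (of_real \<alpha>\<^sub>1 * of_real (h $ 1) + of_real \<beta>\<^sub>1 * of_real (h $ 2)) + ?x) *
           (?y - \<i> * (of_real \<alpha>\<^sub>1 * of_real (l $ 1) + of_real \<beta>\<^sub>1 * of_real (l $ 2))) +
         of_real (\<gamma>\<^sub>2\<^sup>2) * (\<i> * (of_real \<alpha>\<^sub>2 * of_real (h $ 1) + of_real \<beta>\<^sub>2 * of_real (h $ 2)) + ?x) *
           (?y - \<i> * (of_real \<alpha>\<^sub>2 * of_real (l $ 1) + of_real \<beta>\<^sub>2 * of_real (l $ 2))) +
         of_real (\<gamma>\<^sub>3\<^sup>2) * (\<i> * (of_real \<alpha>\<^sub>3 * of_real (h $ 1) + of_real \<beta>\<^sub>3 * of_real (h $ 2)) + ?x) *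
           (?y - \<i> * (of_real \<alpha>\<^sub>3 * of_real (l $ 1) + of_real \<beta>\<^sub>3 * of_real (l $ 2)))) +
        Y ?z * cnj (Y ?z) * of_real (h $ 3 * l $ 3 * (D ?z / C))"
      by (simp add: sum_4 w_def components \<nu>_def mult_ac distrib_left[of "of_real (e ?z)"])
    also have "\<dots> = of_real (e ?z) * (of_real (h $ 1 * l $ 1 + h $ 2 * l $ 2) +
          X ?z * cnj (X ?z) * of_real (h $ 3 * l $ 3 / C)) +
        Y ?z * cnj (Y ?z) * of_real (h $ 3 * l $ 3 * (D ?z / C))"
      unfolding frame(2) by simp
    also have "X ?z * cnj (X ?z) = of_real (D ?z)"
      by (simp add: complex_mult_cnj X_def Dv)
    also have "Y ?z * cnj (Y ?z) = of_real ((e ?z / D ?z)\<^sup>2) * (X ?z * cnj (X ?z))"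
      by (simp add: Y_def power2_eq_square)
    also have "X ?z * cnj (X ?z) = of_real (D ?z)"
      by (simp add: complex_mult_cnj X_def Dv)
    also have "of_real (e ?z) * (of_real (h $ 1 * l $ 1 + h $ 2 * l $ 2) + of_real (D ?z) * of_real (h $ 3 * l $ 3 / C)) +
        of_real ((e ?z / D ?z)\<^sup>2) * of_real (D ?z) * of_real (h $ 3 * l $ 3 * (D ?z / C)) =
      complex_of_real (e ?z * (h $ 1 * l $ 1 + h $ 2 * l $ 2 + D ?z * (h $ 3 * l $ 3 / C)) +
        (e ?z / D ?z)\<^sup>2 * D ?z * (h $ 3 * l $ 3 * (D ?z / C)))"
      by simp
    \<comment> \<open>In the z-direction the first three components contribute
      \<open>e * D / C\<close> and the last one \<open>e\<^sup>2 / C\<close>. As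
      \<open>D + e = C\<close>, they add up to \<open>e\<close>, the conformal factor of the x- and
      y-directions.\<close>
    also have "e ?z * (h $ 1 * l $ 1 + h $ 2 * l $ 2 + D ?z * (h $ 3 * l $ 3 / C)) +
        (e ?z / D ?z)\<^sup>2 * D ?z * (h $ 3 * l $ 3 * (D ?z / C)) =
      e ?z * (h $ 1 * l $ 1 + h $ 2 * l $ 2) + e ?z * (h $ 3 * l $ 3) * ((D ?z + e ?z) / C)"
      using D0[of ?z] by (simp add: power2_eq_square algebra_simps add_divide_distrib)
    also have "(D ?z + e ?z) / C = 1" using C0 by (simp add: e_eq)
    finally show ?thesis by (simp add: E2 inner_vec_def sum_3 algebra_simps)
  qed

  \<comment> \<open>The Laplacian of the lift\<close>
  have sE: "smooth_on UNIV E"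
    unfolding E_def[abs_def]
    using smooth_on_compose_linear[OF bounded_linear_vec_nth open_UNIV subset_UNIV smooth_on_exp_mult[OF u_smooth, of 1]]
    by simp
  have dE: "(E has_derivative (\<lambda>h. h $ 3 * (v (p $ 3) * E p))) (at p)" for p
    unfolding E_def using du[of "p $ 3"]
    by (auto intro!: derivative_eq_intros has_derivative_compose[OF bounded_linear_imp_has_derivative[OF bounded_linear_vec_nth]]
        simp: has_field_derivative_def ac_simps)
  \<comment> \<open>The imaginary part of the coefficient of the z-derivative in
    \<open>profile_laplacian\<close>; its product with \<open>exp (u z)\<close> is the invariant of
    \<open>ode_invariant\<close>.\<close>
  define n where "n z = t z * (3 * (t z)\<^sup>2 - e z - s z) / D z" for z
  define \<kappa> where "\<kappa> = exp (u 0) * n 0"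
  have \<kappa>: "exp (u z) * n z = \<kappa>" for z
  proof -
    have "exp (u z) * n z = c\<^sub>3 * exp (- 2 * u z) *
        (3 * c\<^sub>3\<^sup>2 * exp (- 6 * u z) - exp (2 * u z) - deriv (deriv u) z) * inverse (C - exp (2 * u z))" for z
    proof -
      have "exp (u z) * t z = c\<^sub>3 * exp (- 2 * u z)"
        by (simp add: t_def flip: exp_add)
      moreover have "exp (u z) * n z = exp (u z) * t z * (3 * (t z)\<^sup>2 - e z - s z) * inverse (D z)"
        by (simp add: n_def divide_inverse)
      ultimately show ?thesis by (simp add: t2 e_def s_def D_def)
    qed
    then show ?thesis
      unfolding \<kappa>_def using ode_invariant[OF u_smooth u_ode nonzero_denominators(1), of z] by simp
  qed
  \<comment> \<open>An x-derivative multiplies a component by \<i> times its \<alpha>, so the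
    coefficient \<open>\<i> * (- a * E p)\<close> produces the term \<open>a * \<alpha>\<close> of
    \<open>root_norm\<close>; similarly for \<open>b\<close>. Since \<open>E\<close> depends on z
    alone, the first two entries do not contribute to the divergence.\<close>
  define m where "m i p = (vector [- a * E p, - b * E p, \<kappa>] :: real ^ 3) $ i" for i p
  have m_eq: "m 1 = (\<lambda>p. - a * E p)" "m 2 = (\<lambda>p. - b * E p)" "m 3 = (\<lambda>p. \<kappa>)"
    by (simp_all add: m_def fun_eq_iff)
  have sm: "smooth_on UNIV (m i)" for i
  proof -
    have "\<forall>i. smooth_on UNIV (m i)"
      unfolding forall_3 m_eq by (intro conjI smooth_on_mult smooth_on_const sE open_UNIV)
    then show ?thesis by blast
  qed
  have div: "(\<Sum>i\<in>UNIV. dirderiv (m i) (axis i 1) p) = 0" for p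
  proof -
    have d: "dirderiv (\<lambda>p. r * E p) h p = r * (h $ 3 * (v (p $ 3) * E p))" for r h
      by (rule dirderiv_eq[OF has_derivative_mult_right[OF dE]])
    show ?thesis unfolding sum_3 m_eq d by (simp add: axis_def)
  qed
  \<comment> \<open>For the first three components \<open>norms\<close> trades the frequencies for
    the \<open>2 * C\<close> in the first identity of \<open>profile_laplacian\<close>. The last
    component has frequency 0 and uses the second identity.\<close>
  have key: "S' k z + (S k z)\<^sup>2 - of_real ((\<alpha>' k)\<^sup>2 + (\<beta>' k)\<^sup>2) =
      - 3 * of_real (e z) + of_real (a * \<alpha>' k + b * \<beta>' k) + Complex (- v z) (n z) * S k z" for k z
  proof -
    note L = profile_laplacian[OF Dv D0 e_eq vs n_def, folded X_def X'_def, folded Y_def Y'_def]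
    have "\<forall>k. S' k z + (S k z)\<^sup>2 - of_real ((\<alpha>' k)\<^sup>2 + (\<beta>' k)\<^sup>2) =
        - 3 * of_real (e z) + of_real (a * \<alpha>' k + b * \<beta>' k) + Complex (- v z) (n z) * S k z"
      unfolding forall_4 components norms
      using L(1)[of z] L(2)[of z] by (simp add: algebra_simps)
    then show ?thesis by blast
  qed
  have laplacian: "of_real (E p) *s (\<Sum>i\<in>UNIV. dirderiv (dirderiv \<psi> (axis i 1)) (axis i 1) p) =
      of_real (- 3 * E p * e (p $ 3)) *s \<psi> p +
      (\<Sum>i\<in>UNIV. (of_real (- dirderiv E (axis i 1) p) + \<i> * of_real (m i p)) *s dirderiv \<psi> (axis i 1) p)" for p
    unfolding vec_eq_iff
  proof
    fix k
    let ?z = "p $ 3"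
    have ax: "axis 1 1 $ (3 :: 3) = (0 :: real)" "axis 2 1 $ (3 :: 3) = (0 :: real)" "axis 3 1 $ (3 :: 3) = (1 :: real)"
      by (simp_all add: axis_def)
    have w: "w k (axis 1 1) p = \<i> * of_real (\<alpha>' k)" "w k (axis 2 1) p = \<i> * of_real (\<beta>' k)"
      "w k (axis 3 1) p = S k ?z"
      by (simp_all add: w_def axis_def)
    have "(of_real (E p) *s (\<Sum>i\<in>UNIV. dirderiv (dirderiv \<psi> (axis i 1)) (axis i 1) p)) $ k =
        of_real (E p) * (S' k ?z + (S k ?z)\<^sup>2 - of_real ((\<alpha>' k)\<^sup>2 + (\<beta>' k)\<^sup>2)) * \<psi> p $ k"
      by (simp add: sum_3 dd\<psi> w ax power_mult_distrib algebra_simps)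
    also have "\<dots> = (of_real (- 3 * E p * e ?z) + \<i> * of_real (- a * E p) * (\<i> * of_real (\<alpha>' k)) +
        \<i> * of_real (- b * E p) * (\<i> * of_real (\<beta>' k)) +
        (of_real (- (v ?z * E p)) + \<i> * of_real (E p * n ?z)) * S k ?z) * \<psi> p $ k"
    proof -
      have cx: "Complex (- v ?z) (n ?z) = - of_real (v ?z) + \<i> * of_real (n ?z)"
        by (simp add: complex_eq_iff)
      show ?thesis unfolding key cx by (simp add: algebra_simps)
    qed
    also have "\<dots> = (of_real (- 3 * E p * e ?z) *s \<psi> p +
      (\<Sum>i\<in>UNIV. (of_real (- dirderiv E (axis i 1) p) + \<i> * of_real (m i p)) *s dirderiv \<psi> (axis i 1) p)) $ k"
      by (simp add: \<kappa>[of ?z, symmetric] sum_3 d\<psi> w dirderiv_eq[OF dE] m_eq ax E_def algebra_simps)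
    finally show "(of_real (E p) *s (\<Sum>i\<in>UNIV. dirderiv (dirderiv \<psi> (axis i 1)) (axis i 1) p)) $ k =
      (of_real (- 3 * E p * e ?z) *s \<psi> p +
      (\<Sum>i\<in>UNIV. (of_real (- dirderiv E (axis i 1) p) + \<i> * of_real (m i p)) *s dirderiv \<psi> (axis i 1) p)) $ k" .
  qed

  \<comment> \<open>The period lattice\<close>
  obtain N :: int where N: "N > 0" and N_int: "\<And>\<alpha>. \<alpha> \<in> {\<alpha>\<^sub>1, \<alpha>\<^sub>2, \<alpha>\<^sub>3, \<alpha>\<^sub>1 / (\<alpha>\<^sub>1 - c\<^sub>1), \<alpha>\<^sub>2 / (\<alpha>\<^sub>2 - c\<^sub>1), \<alpha>\<^sub>3 / (\<alpha>\<^sub>3 - c\<^sub>1)} \<Longrightarrow>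
      of_int N * \<alpha> \<in> \<int>"
    by (rule common_denominator[of "{\<alpha>\<^sub>1, \<alpha>\<^sub>2, \<alpha>\<^sub>3, \<alpha>\<^sub>1 / (\<alpha>\<^sub>1 - c\<^sub>1), \<alpha>\<^sub>2 / (\<alpha>\<^sub>2 - c\<^sub>1), \<alpha>\<^sub>3 / (\<alpha>\<^sub>3 - c\<^sub>1)}"])
      (use roots_rat c1_rat in auto)
  define I where "I = integral {0..\<tau>} (\<lambda>z. exp (- 3 * u z) / (exp (2 * u z) - C))"
  obtain K :: int where K: "K > 0" and K_int: "of_int K * (c\<^sub>3 * C / (2 * pi) * I) \<in> \<int>"
    by (rule common_denominator[of "{c\<^sub>3 * C / (2 * pi) * I}"]) (use period_rat in \<open>auto simp: I_def\<close>)
  \<comment> \<open>\<open>c\<^sub>2\<close> may be irrational, but \<open>\<beta>\<^sub>j /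
    c\<^sub>2 = \<alpha>\<^sub>j / (\<alpha>\<^sub>j - c\<^sub>1)\<close> is rational; this is why
    the second side is divided by the absolute value of \<open>c\<^sub>2\<close>, which also keeps
    it positive. \<open>K\<close> repeats the period of \<open>u\<close> until the phases of
    \<open>P\<close> and \<open>Q\<close> differ by a multiple of 2 pi.\<close>
  define T where "T i = (vector [2 * pi * of_int N, 2 * pi * of_int N / \<bar>c\<^sub>2\<bar>, of_int K * \<tau>] :: real ^ 3) $ i" for i
  define A where "A = (\<chi> i j. if i = j then T i else 0)"
  have T_eq: "T 1 = 2 * pi * of_int N" "T 2 = 2 * pi * of_int N / \<bar>c\<^sub>2\<bar>" "T 3 = of_int K * \<tau>"
    by (simp_all add: T_def)
  have T: "T i > 0" for i
  proof -
    have "\<forall>i. T i > 0" unfolding forall_3 T_eq using N K c2 u_periodic(1) by simp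
    then show ?thesis by blast
  qed
  have u_per: "u (z + of_int j * \<tau>) = u z" for z j
    by (rule periodic_of_int) (rule u_periodic(2))
  have phase_diff: "\<theta> (z + of_int j * \<tau>) - \<eta> (z + of_int j * \<tau>) = \<theta> z - \<eta> z - of_int j * (C * I)" for z j
  proof -
    have d: "((\<lambda>z. \<theta> z - \<eta> z) has_real_derivative - C * (exp (- 3 * u z) / (exp (2 * u z) - C))) (at z)" for z
    proof -
      have "exp (- u z) = exp (- 3 * u z) * exp (2 * u z)" by (simp flip: exp_add)
      then have "exp (- 3 * u z) - exp (- u z) / (exp (2 * u z) - C) = - C * (exp (- 3 * u z) / (exp (2 * u z) - C))"
        using nonzero_denominators(1)[of z] by (simp add: field_simps)
      then show ?thesis using DERIV_diff[OF \<theta> \<eta>, of z] by simp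
    qed
    have "(\<lambda>z. \<theta> z - \<eta> z) (z + of_int j * \<tau>) =
        \<theta> z - \<eta> z + of_int j * integral {0..\<tau>} (\<lambda>z. - C * (exp (- 3 * u z) / (exp (2 * u z) - C)))"
      by (rule antiderivative_of_periodic[OF d]) (use u_periodic in simp_all)
    moreover have "integral {0..\<tau>} (\<lambda>z. - C * (exp (- 3 * u z) / (exp (2 * u z) - C))) = - C * I"
      unfolding I_def by (rule integral_mult_right)
    ultimately show ?thesis by simp
  qed
  have lattice: "hopf (\<psi> (p + l)) = hopf (\<psi> p)" if "l \<in> lattice_of A" for p l
  proof -
    obtain i :: "int ^ 3" where l: "l = A *v (\<chi> j. of_int (i $ j))"
      using \<open>l \<in> lattice_of A\<close> by (auto simp: lattice_of_def)
    have lk: "l $ j = T j * of_int (i $ j)" for j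
      unfolding l A_def diagonal_mult_vec by simp
    define q where "q = K * i $ 3"
    have l3: "(p + l) $ 3 = p $ 3 + of_int q * \<tau>" by (simp add: lk T_eq q_def)
    \<comment> \<open>The phase gained by \<open>Q\<close>. \<open>P\<close> gains the same up to a
      multiple of 2 pi, and the common factor \<open>cis \<delta>\<close> disappears under
      \<open>hopf\<close>.\<close>
    define \<delta> where "\<delta> = c\<^sub>3 * (\<eta> (p $ 3 + of_int q * \<tau>) - \<eta> (p $ 3))"
    have Q\<delta>: "Q ((p + l) $ 3) = cis \<delta> * Q (p $ 3)"
      unfolding l3 Q_eq D_def e_def u_per by (simp add: \<delta>_def cis_mult algebra_simps)
    have P\<delta>: "P ((p + l) $ 3) = cis \<delta> * P (p $ 3)"
    proof -
      obtain r :: int where r: "of_int K * (c\<^sub>3 * C / (2 * pi) * I) = of_int r"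
        using K_int Ints_cases by blast
      have "of_int q * (c\<^sub>3 * (C * I)) = 2 * pi * of_int (r * i $ 3)"
        using arg_cong[OF r, of "\<lambda>x. 2 * pi * x * of_int (i $ 3)"] by (simp add: q_def field_simps)
      moreover have "c\<^sub>3 * \<theta> (p $ 3 + of_int q * \<tau>) = \<delta> + c\<^sub>3 * \<theta> (p $ 3) - of_int q * (c\<^sub>3 * (C * I))"
        using arg_cong[OF phase_diff[of "p $ 3" q], of "\<lambda>x. c\<^sub>3 * x"] by (simp add: \<delta>_def algebra_simps)
      ultimately have "c\<^sub>3 * \<theta> (p $ 3 + of_int q * \<tau>) = \<delta> + c\<^sub>3 * \<theta> (p $ 3) - 2 * pi * of_int (r * i $ 3)"
        by simp
      moreover have "cis (x - 2 * pi * of_int j) = cis x" for x j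
        using cis_multiple_2pi[of "of_int j"] by (simp flip: cis_divide)
      ultimately have "cis (c\<^sub>3 * \<theta> (p $ 3 + of_int q * \<tau>)) = cis \<delta> * cis (c\<^sub>3 * \<theta> (p $ 3))"
        by (simp only: cis_mult)
      then show ?thesis
        unfolding l3 P_eq u_per by (simp only: mult_ac)
    qed
    have phase: "cis (\<alpha> * (p + l) $ 1 + c\<^sub>2 * \<alpha> / (\<alpha> - c\<^sub>1) * (p + l) $ 2) =
        cis (\<alpha> * p $ 1 + c\<^sub>2 * \<alpha> / (\<alpha> - c\<^sub>1) * p $ 2)"
      if "of_int N * \<alpha> \<in> \<int>" "of_int N * (\<alpha> / (\<alpha> - c\<^sub>1)) \<in> \<int>" for \<alpha>
    proof -
      have "c\<^sub>2 * \<alpha> / (\<alpha> - c\<^sub>1) * l $ 2 = 2 * pi * (sgn c\<^sub>2 * (of_int N * (\<alpha> / (\<alpha> - c\<^sub>1))) * of_int (i $ 2))"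
        using c2 by (simp add: lk T_eq sgn_if)
      then have "\<alpha> * (p + l) $ 1 + c\<^sub>2 * \<alpha> / (\<alpha> - c\<^sub>1) * (p + l) $ 2 =
          (\<alpha> * p $ 1 + c\<^sub>2 * \<alpha> / (\<alpha> - c\<^sub>1) * p $ 2) + 2 * pi * (of_int N * \<alpha> * of_int (i $ 1) +
            sgn c\<^sub>2 * (of_int N * (\<alpha> / (\<alpha> - c\<^sub>1))) * of_int (i $ 2))"
        by (simp add: lk T_eq distrib_left mult_ac)
      moreover have "of_int N * \<alpha> * of_int (i $ 1) + sgn c\<^sub>2 * (of_int N * (\<alpha> / (\<alpha> - c\<^sub>1))) * of_int (i $ 2) \<in> \<int>"
        by (intro Ints_add Ints_mult that Ints_of_int) (simp add: sgn_if)
      ultimately show ?thesis by (simp add: cis_multiple_2pi flip: cis_mult)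
    qed
    have "\<psi> (p + l) $ k = cis \<delta> * \<psi> p $ k" for k
    proof -
      have "\<forall>k. \<psi> (p + l) $ k = cis \<delta> * \<psi> p $ k"
        unfolding forall_4 \<psi>k components P\<delta> Q\<delta>
        using phase[OF N_int N_int, of \<alpha>\<^sub>1] phase[OF N_int N_int, of \<alpha>\<^sub>2] phase[OF N_int N_int, of \<alpha>\<^sub>3]
        by (simp add: \<beta> mult_ac)
      then show ?thesis by blast
    qed
    then have "\<psi> (p + l) = cis \<delta> *s \<psi> p" by (simp add: vec_eq_iff)
    then show ?thesis by (simp add: hopf_cis)
  qed

  \<comment> \<open>Assembling the four properties\<close>
  have dhopf: "dhopf \<psi> p h = dirderiv \<psi> h p" for p h
    by (simp add: dhopf_def horizontal_def hor)
  have fs: "fs_form \<psi> p h l = of_real ((E p)\<^sup>2 * (h \<bullet> l))" for p h l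
    by (simp add: fs_form_def dhopf conf)
  have "immersed_torus A \<psi>"
    unfolding immersed_torus_def
  proof (intro conjI allI impI ballI)
    have "det A = (\<Prod>i\<in>UNIV. T i)"
      using det_diagonal[of A] by (simp add: A_def)
    moreover have "(\<Prod>i\<in>UNIV. T i) \<noteq> 0" using T[THEN less_imp_neq] by simp
    ultimately show "invertible A" by (simp add: invertible_det_nz)
    show "dhopf \<psi> p h \<noteq> 0" if "h \<noteq> 0" for p h
    proof
      assume "dhopf \<psi> p h = 0"
      then have "herm (dirderiv \<psi> h p) (dirderiv \<psi> h p) = 0" by (simp add: dhopf herm_def)
      then show False using that Epos[of p] unfolding conf of_real_eq_0_iff by simp
    qed
  qed (use smooth sphere lattice in auto)
  moreover have "lagrangian \<psi>"
    by (simp add: lagrangian_def fs)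
  moreover have "conformally_flat \<psi>"
    unfolding conformally_flat_def
    by (rule exI[of _ "\<lambda>p. (E p)\<^sup>2"]) (use Epos[THEN less_imp_neq] in \<open>simp add: fs\<close>)
  moreover have "hamiltonian_minimal A \<psi>"
    unfolding A_def
  proof (rule hamiltonian_minimalI[OF smooth sphere hor conf sE Epos sm laplacian div T])
    show per: "E (p + T i *\<^sub>R axis i 1) = E p" for p i
    proof -
      have "\<forall>i. E (p + T i *\<^sub>R axis i 1) = E p"
        unfolding forall_3 E_def T_eq using u_per[of "p $ 3" K] by (simp add: axis_def)
      then show ?thesis by blast
    qed
    show "m i (p + T i *\<^sub>R axis i 1) = m i p" for p i
      using per[of p i] by (simp add: m_def)
  qed
  ultimately show ?thesis using sphere by blast
qed

end
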